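(* Let $l\ge 2$, $n=2l$ and $\varepsilon=1$. Let $\mathcal{A}=\mathcal{A}_n$ be the Seesaw algebra with its symmetry $\sigma$, let $V$ be the $\mathcal{Q}_0$-graded complex vector space of dimension vector $\mathbf{d}=(1,2,\dots,l-1,l,n,l,l-1,\dots,2,1)$ with the bilinear form $\langle-,-\rangle$, and let $M,N\in R(\mathcal{A},V)^{\langle-,-\rangle,1}$ be the two orthogonal representations, all as defined in the context. Then: (1) $N\in\overline{\mathrm{GL}^\bullet(V)\cdot M}$, i.e. $M$ degenerates to $N$ in $R(\mathcal{A},V)$; (2) $N\notin\overline{\mathrm{G}^\bullet(V,\langle-,-\rangle)\cdot M}$, i.e. $M$ does not degenerate to $N$ symmetrically. In particular, the degeneration order and the symmetric degeneration order do not coincide on $R(\mathcal{A},V)^{\langle-,-\rangle,1}$.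
   Context: The base field is $\mathrm{k}=\mathbb{C}$; closures are Zariski closures. Seesaw algebra. For $n\in\{2l,2l+1\}$, let $\mathcal{Q}$ be the quiver with vertices $1,\dots,l,\omega,l^*,\dots,1^*$ and arrows $a_i:i\to i+1$ ($1\le i\le l-1$), $a_l:l\to\omega$, a loop $\gamma:\omega\to\omega$, $a_l^*:\omega\to l^*$, and $a_i^*:(i+1)^*\to i^*$ ($1\le i\le l-1$). The symmetry $\sigma$ is the arrow-reversing involution with $\sigma(i)=i^*$, $\sigma(\omega)=\omega$, $\sigma(a_i)=a_i^*$, $\sigma(\gamma)=\gamma$. The Seesaw algebra is $\mathcal{A}_n=\mathrm{k}\mathcal{Q}/I$ with $I=(\gamma^2,\,a_l^*a_l)$. Representations. For a $\mathcal{Q}_0$-graded vector space $V=\bigoplus_i V_i$, $R(\mathcal{A},V)$ is the variety of tuples of linear maps $(f_\alpha:V_{s(\alpha)}\to V_{t(\alpha)})_{\alpha\in\mathcal{Q}_1}$ satisfying the relations in $I$. The group $\mathrm{GL}^\bullet(V)=\prod_i\mathrm{GL}(V_i)$ acts by $(g\cdot M)_\alpha=g_{t(\alpha)}M_\alpha g_{s(\alpha)}^{-1}$. A representation is viewed as an endomorphism of $V$ (the sum of its maps). Symmetric representations. Let $\varepsilon\in\{\pm1\}$ and let $\langle-,-\rangle$ be a non-degenerate bilinear form on $V$ with $\langle v,w\rangle=\varepsilon\langle w,v\rangle$ and $\langle V_i,V_j\rangle=0$ unless $j=\sigma(i)$. Then $R(\mathcal{A},V)^{\langle-,-\rangle,\varepsilon}$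 is the set of $M\in R(\mathcal{A},V)$ with $\langle Mv,w\rangle+\langle v,Mw\rangle=0$ for all $v,w\in V$ (called orthogonal representations if $\varepsilon=1$). $\mathrm{G}^\bullet(V,\langle-,-\rangle)$ is the group of those $g\in\mathrm{GL}^\bullet(V)$ which are isometries of $(V,\langle-,-\rangle)$; it acts on $R(\mathcal{A},V)^{\langle-,-\rangle,\varepsilon}$. For $M,N\in R(\mathcal{A},V)$, the degeneration order is $M\le_{\deg}N:\Leftrightarrow N\in\overline{\mathrm{GL}^\bullet(V)\cdot M}$; for $M,N\in R(\mathcal{A},V)^{\langle-,-\rangle,\varepsilon}$, the symmetric degeneration order is $M\le^{\varepsilon}_{\deg}N:\Leftrightarrow N\in\overline{\mathrm{G}^\bullet(V,\langle-,-\rangle)\cdot M}$. The space $V$ and its form (for $n=2l$, $\varepsilon=1$). Here $\dim V_i=\dim V_{i^*}=i$ and $\dim V_\omega=n$. Bases: $v^{(i)}_1,\dots,v^{(i)}_i$ of $V_i$; $v^{(i^* )}_1,\dots,v^{(i^* )}_i$ of $V_{i^*}$; and $v^{(\omega)}_1,\dots,v^{(\omega)}_l,v^{(\omega^* )}_1,\dots,v^{(\omega^* )}_l$ of $V_\omega$. The form is zero on pairs of basis vectors except $\langle v^{(i)}_k,v^{(i^* )}_k\rangle=\langle v^{(i^* )}_k,v^{(i)}_k\rangle=1$ and $\langle v^{(\omega)}_k,v^{(\omega^* )}_k\rangle=\langle v^{(\omega^* )}_k,v^{(\omega)}_k\rangle=1$. The representations $M$ and $N$. Both have the same maps along all $a_i$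 and $a_i^*$: $a_i$ acts by $v^{(i)}_k\mapsto v^{(i+1)}_k$ for $i<l$; $a_l$ acts by $v^{(l)}_k\mapsto v^{(\omega)}_k$; $a_l^*$ acts by $v^{(\omega^* )}_k\mapsto -v^{(l^* )}_k$ and $v^{(\omega)}_k\mapsto 0$; and for $i<l$, $a_i^*$ acts by $v^{((i+1)^* )}_k\mapsto -v^{(i^* )}_k$ for $k\le i$ and $v^{((i+1)^* )}_{i+1}\mapsto0$. The loop acts by: $M_\gamma(v^{(\omega)}_1)=v^{(\omega^* )}_l$, $M_\gamma(v^{(\omega)}_l)=-v^{(\omega^* )}_1$, and $M_\gamma$ is zero on all other basis vectors of $V_\omega$; $N_\gamma(v^{(\omega)}_1)=v^{(\omega)}_l$, $N_\gamma(v^{(\omega^* )}_l)=-v^{(\omega^* )}_1$, and $N_\gamma$ is zero on all other basis vectors of $V_\omega$. *)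

theory Defs
  imports
    "Graph_Theory.Digraph"
    "Jordan_Normal_Form.Matrix"
    "HOL-Library.FuncSet"
begin

section \<open>Bound quivers with a symmetry and their representations\<close>

text \<open>
  A quiver is a \<open>pre_digraph\<close> (\<open>tail\<close> is the source, \<open>head\<close> the target).
  The algebra is presented by paths that are set to zero; a path is the nonempty list of
  its arrows in the order of composition of maps, so \<open>[\<beta>, \<alpha>]\<close> is "first \<open>\<alpha>\<close>, then \<open>\<beta>\<close>".
  The two duals are the values of the symmetry on vertices and on arrows.
\<close>

record ('v, 'a) bound_quiver = "('v, 'a) pre_digraph" +
  zero_paths :: "'a list set"
  vdual :: "'v \<Rightarrow> 'v"
  adual :: "'a \<Rightarrow> 'a"

text \<open>
  A graded vector space is given by its dimension vector \<open>d\<close>, with \<open>V\<^sub>i = \<complex>\<^bsup>d i\<^esup>\<close>.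
  Families indexed by vertices or arrows are extensional functions.
\<close>

definition graded_space ::
  "('v, 'a, 'm) bound_quiver_scheme \<Rightarrow> ('v \<Rightarrow> nat) \<Rightarrow> ('v \<Rightarrow> complex vec) set" where
  "graded_space Q d = (\<Pi>\<^sub>E i\<in>verts Q. carrier_vec (d i))"

definition graded_part ::
  "('v, 'a, 'm) bound_quiver_scheme \<Rightarrow> ('v \<Rightarrow> nat) \<Rightarrow> 'v \<Rightarrow> ('v \<Rightarrow> complex vec) set" where
  "graded_part Q d i =
     {v \<in> graded_space Q d. \<forall>j\<in>verts Q. j \<noteq> i \<longrightarrow> v j = 0\<^sub>v (d j)}"

definition rep_space ::
  "('v, 'a, 'm) bound_quiver_scheme \<Rightarrow> ('v \<Rightarrow> nat) \<Rightarrow> ('a \<Rightarrow> complex mat) set" where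
  "rep_space Q d = (\<Pi>\<^sub>E \<alpha>\<in>arcs Q. carrier_mat (d (head Q \<alpha>)) (d (tail Q \<alpha>)))"

fun path_map :: "('a \<Rightarrow> complex mat) \<Rightarrow> 'a list \<Rightarrow> complex mat" where
  "path_map M [\<alpha>] = M \<alpha>"
| "path_map M (\<alpha> # \<beta> # p) = M \<alpha> * path_map M (\<beta> # p)"

text \<open>
  It suffices to impose the generators: the maps along all other elements of the ideal
  then vanish as well.
\<close>

definition rep_variety ::
  "('v, 'a, 'm) bound_quiver_scheme \<Rightarrow> ('v \<Rightarrow> nat) \<Rightarrow> ('a \<Rightarrow> complex mat) set" where
  "rep_variety Q d =
     {M \<in> rep_space Q d. \<forall>p\<in>zero_paths Q.
        path_map M p = 0\<^sub>m (d (head Q (hd p))) (d (tail Q (last p)))}"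

definition GL_graded ::
  "('v, 'a, 'm) bound_quiver_scheme \<Rightarrow> ('v \<Rightarrow> nat) \<Rightarrow> ('v \<Rightarrow> complex mat) set" where
  "GL_graded Q d = (\<Pi>\<^sub>E i\<in>verts Q. Units (ring_mat TYPE(complex) (d i) ()))"

definition rep_act ::
  "('v, 'a, 'm) bound_quiver_scheme \<Rightarrow> ('v \<Rightarrow> nat) \<Rightarrow> ('v \<Rightarrow> complex mat)
     \<Rightarrow> ('a \<Rightarrow> complex mat) \<Rightarrow> ('a \<Rightarrow> complex mat)" where
  "rep_act Q d g M =
     (\<lambda>\<alpha>\<in>arcs Q. g (head Q \<alpha>) * M \<alpha> *
        m_inv (ring_mat TYPE(complex) (d (tail Q \<alpha>)) ()) (g (tail Q \<alpha>)))"

definition vec_act ::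
  "('v, 'a, 'm) bound_quiver_scheme \<Rightarrow> ('v \<Rightarrow> complex mat)
     \<Rightarrow> ('v \<Rightarrow> complex vec) \<Rightarrow> ('v \<Rightarrow> complex vec)" where
  "vec_act Q g v = (\<lambda>i\<in>verts Q. g i *\<^sub>v v i)"

text \<open>The endomorphism of \<open>V\<close> that is the sum of all maps of the representation.\<close>

definition rep_endo ::
  "('v, 'a, 'm) bound_quiver_scheme \<Rightarrow> ('v \<Rightarrow> nat) \<Rightarrow> ('a \<Rightarrow> complex mat)
     \<Rightarrow> ('v \<Rightarrow> complex vec) \<Rightarrow> ('v \<Rightarrow> complex vec)" where
  "rep_endo Q d M v =
     (\<lambda>j\<in>verts Q. vec (d j) (\<lambda>k. \<Sum>\<alpha> | \<alpha> \<in> arcs Q \<and> head Q \<alpha> = j.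
        (M \<alpha> *\<^sub>v v (tail Q \<alpha>)) $ k))"


section \<open>Symmetric representations\<close>

type_synonym 'v graded_form = "('v \<Rightarrow> complex vec) \<Rightarrow> ('v \<Rightarrow> complex vec) \<Rightarrow> complex"

definition eps_form ::
  "('v, 'a, 'm) bound_quiver_scheme \<Rightarrow> ('v \<Rightarrow> nat) \<Rightarrow> complex \<Rightarrow> 'v graded_form \<Rightarrow> bool" where
  "eps_form Q d \<epsilon> F \<longleftrightarrow>
     (\<forall>u\<in>graded_space Q d. \<forall>v\<in>graded_space Q d. \<forall>w\<in>graded_space Q d. \<forall>a b.
        F (\<lambda>i\<in>verts Q. a \<cdot>\<^sub>v u i + b \<cdot>\<^sub>v v i) w = a * F u w + b * F v w \<and>
        F w (\<lambda>i\<in>verts Q. a \<cdot>\<^sub>v u i + b \<cdot>\<^sub>v v i) = a * F w u + b * F w v) \<and>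
     (\<forall>v\<in>graded_space Q d.
        (\<forall>w\<in>graded_space Q d. F v w = 0) \<longrightarrow> v = (\<lambda>i\<in>verts Q. 0\<^sub>v (d i))) \<and>
     (\<forall>v\<in>graded_space Q d. \<forall>w\<in>graded_space Q d. F v w = \<epsilon> * F w v) \<and>
     (\<forall>i\<in>verts Q. \<forall>j\<in>verts Q. j \<noteq> vdual Q i \<longrightarrow>
        (\<forall>v\<in>graded_part Q d i. \<forall>w\<in>graded_part Q d j. F v w = 0))"

text \<open>
  The sign \<open>\<epsilon>\<close> enters only through the form; for an \<open>eps_form\<close> with sign 1 these are the
  orthogonal representations.
\<close>

definition sym_rep_variety ::
  "('v, 'a, 'm) bound_quiver_scheme \<Rightarrow> ('v \<Rightarrow> nat) \<Rightarrow> 'v graded_form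
     \<Rightarrow> ('a \<Rightarrow> complex mat) set" where
  "sym_rep_variety Q d F =
     {M \<in> rep_variety Q d. \<forall>v\<in>graded_space Q d. \<forall>w\<in>graded_space Q d.
        F (rep_endo Q d M v) w + F v (rep_endo Q d M w) = 0}"

definition isometry_graded ::
  "('v, 'a, 'm) bound_quiver_scheme \<Rightarrow> ('v \<Rightarrow> nat) \<Rightarrow> 'v graded_form
     \<Rightarrow> ('v \<Rightarrow> complex mat) set" where
  "isometry_graded Q d F =
     {g \<in> GL_graded Q d. \<forall>v\<in>graded_space Q d. \<forall>w\<in>graded_space Q d.
        F (vec_act Q g v) (vec_act Q g w) = F v w}"


section \<open>Zariski closure and degeneration orders\<close>

text \<open>Polynomial functions in the matrix entries of a representation.\<close>

inductive_set rep_polys ::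
  "('v, 'a, 'm) bound_quiver_scheme \<Rightarrow> ('v \<Rightarrow> nat) \<Rightarrow> (('a \<Rightarrow> complex mat) \<Rightarrow> complex) set"
  for Q :: "('v, 'a, 'm) bound_quiver_scheme" and d :: "'v \<Rightarrow> nat" where
  const: "(\<lambda>_. c) \<in> rep_polys Q d"
| coord: "\<alpha> \<in> arcs Q \<Longrightarrow> r < d (head Q \<alpha>) \<Longrightarrow> s < d (tail Q \<alpha>) \<Longrightarrow>
    (\<lambda>M. M \<alpha> $$ (r, s)) \<in> rep_polys Q d"
| add: "p \<in> rep_polys Q d \<Longrightarrow> q \<in> rep_polys Q d \<Longrightarrow> (\<lambda>M. p M + q M) \<in> rep_polys Q d"
| mult: "p \<in> rep_polys Q d \<Longrightarrow> q \<in> rep_polys Q d \<Longrightarrow> (\<lambda>M. p M * q M) \<in> rep_polys Q d"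

definition zariski_closed ::
  "('v, 'a, 'm) bound_quiver_scheme \<Rightarrow> ('v \<Rightarrow> nat) \<Rightarrow> ('a \<Rightarrow> complex mat) set \<Rightarrow> bool" where
  "zariski_closed Q d Z \<longleftrightarrow>
     (\<exists>P \<subseteq> rep_polys Q d. Z = {M \<in> rep_variety Q d. \<forall>p\<in>P. p M = 0})"

text \<open>
  For a subset of the representation variety, \<open>zariski_closed Q d hull S\<close> is its closure in
  that variety (the intersection of the closed sets containing it).
\<close>

definition deg_le ::
  "('v, 'a, 'm) bound_quiver_scheme \<Rightarrow> ('v \<Rightarrow> nat)
     \<Rightarrow> ('a \<Rightarrow> complex mat) \<Rightarrow> ('a \<Rightarrow> complex mat) \<Rightarrow> bool" where
  "deg_le Q d M N \<longleftrightarrow>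
     N \<in> zariski_closed Q d hull ((\<lambda>g. rep_act Q d g M) ` GL_graded Q d)"

definition sym_deg_le ::
  "('v, 'a, 'm) bound_quiver_scheme \<Rightarrow> ('v \<Rightarrow> nat) \<Rightarrow> 'v graded_form
     \<Rightarrow> ('a \<Rightarrow> complex mat) \<Rightarrow> ('a \<Rightarrow> complex mat) \<Rightarrow> bool" where
  "sym_deg_le Q d F M N \<longleftrightarrow>
     N \<in> zariski_closed Q d hull ((\<lambda>g. rep_act Q d g M) ` isometry_graded Q d F)"


section \<open>The Seesaw algebra\<close>

text \<open>
  \<open>Vtx i\<close> is the vertex \<open>i\<close> and \<open>VtxS i\<close> is \<open>i\<^sup>*\<close>; likewise \<open>Arr i\<close> is \<open>a\<^sub>i\<close> and \<open>ArrS i\<close> is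
  \<open>a\<^sub>i\<^sup>*\<close>, with \<open>1 \<le> i \<le> l\<close> throughout.
\<close>

datatype seesaw_vertex = Vtx nat | Omega | VtxS nat

datatype seesaw_arrow = Arr nat | Gamma | ArrS nat

fun seesaw_tail :: "nat \<Rightarrow> seesaw_arrow \<Rightarrow> seesaw_vertex" where
  "seesaw_tail l (Arr i) = Vtx i"
| "seesaw_tail l Gamma = Omega"
| "seesaw_tail l (ArrS i) = (if i = l then Omega else VtxS (i + 1))"

fun seesaw_head :: "nat \<Rightarrow> seesaw_arrow \<Rightarrow> seesaw_vertex" where
  "seesaw_head l (Arr i) = (if i = l then Omega else Vtx (i + 1))"
| "seesaw_head l Gamma = Omega"
| "seesaw_head l (ArrS i) = VtxS i"

fun seesaw_vdual :: "seesaw_vertex \<Rightarrow> seesaw_vertex" where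
  "seesaw_vdual (Vtx i) = VtxS i"
| "seesaw_vdual Omega = Omega"
| "seesaw_vdual (VtxS i) = Vtx i"

fun seesaw_adual :: "seesaw_arrow \<Rightarrow> seesaw_arrow" where
  "seesaw_adual (Arr i) = ArrS i"
| "seesaw_adual Gamma = Gamma"
| "seesaw_adual (ArrS i) = Arr i"

text \<open>The bound quiver of the Seesaw algebra is the same for \<open>n = 2 l\<close> and \<open>n = 2 l + 1\<close>.\<close>

definition seesaw :: "nat \<Rightarrow> (seesaw_vertex, seesaw_arrow) bound_quiver" where
  "seesaw l =
     \<lparr> verts = Vtx ` {1..l} \<union> {Omega} \<union> VtxS ` {1..l},
       arcs = Arr ` {1..l} \<union> {Gamma} \<union> ArrS ` {1..l},
       tail = seesaw_tail l,
       head = seesaw_head l,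
       zero_paths = {[Gamma, Gamma], [ArrS l, Arr l]},
       vdual = seesaw_vdual,
       adual = seesaw_adual \<rparr>"

lemma seesaw_adual_reverses:
  "tail (seesaw l) (adual (seesaw l) \<alpha>) = vdual (seesaw l) (head (seesaw l) \<alpha>)"
  "head (seesaw l) (adual (seesaw l) \<alpha>) = vdual (seesaw l) (tail (seesaw l) \<alpha>)"
  by (cases \<alpha>; simp add: seesaw_def)+


section \<open>The orthogonal space and the two representations for \<open>n = 2 l\<close>\<close>

text \<open>
  Vectors and matrices are indexed from 0: \<open>v\<^sup>(\<^sup>i\<^sup>)\<^sub>k\<close> and \<open>v\<^sup>(\<^sup>i\<^sup>*\<^sup>)\<^sub>k\<close> are the unit vectors with index
  \<open>k - 1\<close>; in \<open>V\<^sub>\<omega>\<close> the vector \<open>v\<^sup>(\<^sup>\<omega>\<^sup>)\<^sub>k\<close> has index \<open>k - 1\<close> and \<open>v\<^sup>(\<^sup>\<omega>\<^sup>*\<^sup>)\<^sub>k\<close> has index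
  \<open>l + k - 1\<close>.
\<close>

fun seesaw_dim :: "nat \<Rightarrow> seesaw_vertex \<Rightarrow> nat" where
  "seesaw_dim l (Vtx i) = i"
| "seesaw_dim l Omega = 2 * l"
| "seesaw_dim l (VtxS i) = i"

definition seesaw_form :: "nat \<Rightarrow> seesaw_vertex graded_form" where
  "seesaw_form l v w =
     (\<Sum>i=1..l. \<Sum>k<i. v (Vtx i) $ k * w (VtxS i) $ k + v (VtxS i) $ k * w (Vtx i) $ k) +
     (\<Sum>k<l. v Omega $ k * w Omega $ (l + k) + v Omega $ (l + k) * w Omega $ k)"

text \<open>
  Column \<open>c\<close> of each matrix is the image of the basis vector with index \<open>c\<close>; the parameter
  \<open>X\<close> is the map along the loop.
\<close>

fun seesaw_maps :: "nat \<Rightarrow> complex mat \<Rightarrow> seesaw_arrow \<Rightarrow> complex mat" where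
  "seesaw_maps l X (Arr i) =
     (if i = l then mat (2 * l) l (\<lambda>(r, c). if r = c then 1 else 0)
      else mat (i + 1) i (\<lambda>(r, c). if r = c then 1 else 0))"
| "seesaw_maps l X Gamma = X"
| "seesaw_maps l X (ArrS i) =
     (if i = l then mat l (2 * l) (\<lambda>(r, c). if c = l + r then - 1 else 0)
      else mat i (i + 1) (\<lambda>(r, c). if r = c then - 1 else 0))"

definition M_gamma :: "nat \<Rightarrow> complex mat" where
  "M_gamma l = mat (2 * l) (2 * l)
     (\<lambda>(r, c). if c = 0 \<and> r = 2 * l - 1 then 1
               else if c = l - 1 \<and> r = l then - 1 else 0)"

definition N_gamma :: "nat \<Rightarrow> complex mat" where
  "N_gamma l = mat (2 * l) (2 * l)
     (\<lambda>(r, c). if c = 0 \<and> r = l - 1 then 1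
               else if c = 2 * l - 1 \<and> r = l then - 1 else 0)"

definition M_rep :: "nat \<Rightarrow> seesaw_arrow \<Rightarrow> complex mat" where
  "M_rep l = restrict (seesaw_maps l (M_gamma l)) (arcs (seesaw l))"

definition N_rep :: "nat \<Rightarrow> seesaw_arrow \<Rightarrow> complex mat" where
  "N_rep l = restrict (seesaw_maps l (N_gamma l)) (arcs (seesaw l))"

end

theory Submission
  imports Defs "Jordan_Normal_Form.Determinant"
begin

text \<open>
  Write \<open>e\<^sub>k, e\<^sub>k\<^sup>*\<close> for the basis of \<open>V\<^sub>\<omega>\<close>, let \<open>U\<close> be the span of \<open>e\<^sub>1, \<dots>, e\<^sub>l\<close> and \<open>U'\<close> the
  span of \<open>e\<^sub>1, \<dots>, e\<^bsub>l-1\<^esub>, e\<^sub>l\<^sup>*\<close>.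

  The loop \<open>e\<^sub>1 \<mapsto> e\<^sub>l + t e\<^sub>l\<^sup>*, e\<^sub>l \<mapsto> t e\<^sub>1\<^sup>*, e\<^sub>l\<^sup>* \<mapsto> - e\<^sub>1\<^sup>*\<close> gives a representation that is isomorphic
  to \<open>M\<close> for \<open>t \<noteq> 0\<close> and equal to \<open>N\<close> for \<open>t = 0\<close>, so \<open>M\<close> degenerates to \<open>N\<close>.

  On the other hand \<open>U\<close> and \<open>U'\<close> are maximal isotropic and meet in codimension one, so they belong to
  different families. For an isometry \<open>g\<close>, at most one of \<open>g U\<close> and \<open>g U'\<close> is therefore
  complementary to the span of all \<open>e\<^sub>k\<^sup>*\<close>. The first is the image of \<open>a\<^sub>l\<close>, and the second is
  spanned by the image of \<open>a\<^sub>l a\<^bsub>l-1\<^esub>\<close> together with that of \<open>\<gamma> a\<^sub>l a\<^bsub>l-1\<^esub>\<close>, so a product of two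
  minors vanishes on the symmetric orbit of \<open>M\<close>. For \<open>N\<close> both spans are \<open>U\<close>, and the product is 1.
\<close>

section \<open>Matrices and isotropic subspaces\<close>

lemma index_mult_mat_sum:
  assumes "A \<in> carrier_mat nr n" "B \<in> carrier_mat n nc" "i < nr" "j < nc"
  shows "(A * B) $$ (i, j) = (\<Sum>k<n. A $$ (i, k) * B $$ (k, j))"
  using assms by (auto simp: scalar_prod_def lessThan_atLeast0 intro!: sum.cong)

lemma index_mult_mat_vec_sum:
  assumes "A \<in> carrier_mat nr n" "v \<in> carrier_vec n" "i < nr"
  shows "(A *\<^sub>v v) $ i = (\<Sum>k<n. A $$ (i, k) * v $ k)"
  using assms by (auto simp: scalar_prod_def lessThan_atLeast0 intro!: sum.cong)

lemma mult_mat_assoc_dims: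
  fixes A B C :: "'a::semiring_0 mat"
  assumes "dim_col A = dim_row B" "dim_col B = dim_row C"
  shows "A * B * C = A * (B * C)"
  using assms by (intro assoc_mult_mat) auto

lemma mult_mat_vec_assoc_dims:
  fixes A B :: "'a::semiring_0 mat"
  assumes "dim_col A = dim_row B" "dim_col B = dim_vec v"
  shows "A * B *\<^sub>v v = A *\<^sub>v (B *\<^sub>v v)"
  using assms by (intro assoc_mult_mat_vec) auto

lemma det_nonzero_mult_mat_vec_eq_0:
  fixes A :: "'a::field mat"
  assumes "A \<in> carrier_mat n n" "det A \<noteq> 0" "v \<in> carrier_vec n" "A *\<^sub>v v = 0\<^sub>v n"
  shows "v = 0\<^sub>v n"
  using assms det_0_iff_vec_prod_zero_field[OF assms(1)] by blast

lemma det_nonzero_mult_mat_vec_surj: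
  fixes A :: "'a::field mat"
  assumes A: "A \<in> carrier_mat n n" and d: "det A \<noteq> 0" and v: "v \<in> carrier_vec n"
  obtains u where "u \<in> carrier_vec n" "A *\<^sub>v u = v"
proof -
  from det_non_zero_imp_unit[OF A d, of "()"]
  obtain B where B: "B \<in> carrier_mat n n" "A * B = 1\<^sub>m n"
    unfolding Units_def ring_mat_def by auto
  have "A *\<^sub>v (B *\<^sub>v v) = v"
    using A B v by (metis assoc_mult_mat_vec one_mult_mat_vec)
  then show ?thesis
    using that[of "B *\<^sub>v v"] B v by simp
qed

lemma mult_unit_vec_col:
  fixes A :: "'a::semiring_1 mat"
  assumes "A \<in> carrier_mat nr n" "c < n"
  shows "A *\<^sub>v unit_vec n c = col A c"
  using assms by (intro eq_vecI) auto

lemma Units_ring_mat_inv: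
  assumes "g \<in> Units (ring_mat TYPE(complex) n ())"
  shows "g \<in> carrier_mat n n" "m_inv (ring_mat TYPE(complex) n ()) g \<in> carrier_mat n n"
    "m_inv (ring_mat TYPE(complex) n ()) g * g = 1\<^sub>m n"
    "g * m_inv (ring_mat TYPE(complex) n ()) g = 1\<^sub>m n"
proof -
  interpret ring "ring_mat TYPE(complex) n ()" by (rule ring_mat)
  show "g \<in> carrier_mat n n" "m_inv (ring_mat TYPE(complex) n ()) g \<in> carrier_mat n n"
    using Units_closed[OF assms] Units_inv_closed[OF assms] by (simp_all add: ring_mat_simps)
  show "m_inv (ring_mat TYPE(complex) n ()) g * g = 1\<^sub>m n"
    "g * m_inv (ring_mat TYPE(complex) n ()) g = 1\<^sub>m n"
    using Units_l_inv[OF assms] Units_r_inv[OF assms] by (simp_all add: ring_mat_simps)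
qed

definition hyp_form :: "nat \<Rightarrow> complex vec \<Rightarrow> complex vec \<Rightarrow> complex" where
  "hyp_form l v w = (\<Sum>k<l. v $ k * w $ (l + k) + v $ (l + k) * w $ k)"

lemma hyp_form_commute: "hyp_form l v w = hyp_form l w v"
  by (simp add: hyp_form_def algebra_simps)

lemma hyp_form_add_left:
  assumes "u \<in> carrier_vec (2 * l)" "v \<in> carrier_vec (2 * l)"
  shows "hyp_form l (u + v) w = hyp_form l u w + hyp_form l v w"
  using assms by (auto simp: hyp_form_def algebra_simps sum.distrib[symmetric] intro!: sum.cong)

lemma hyp_form_add_right:
  assumes "u \<in> carrier_vec (2 * l)" "v \<in> carrier_vec (2 * l)"
  shows "hyp_form l w (u + v) = hyp_form l w u + hyp_form l w v"
  using hyp_form_add_left[OF assms] by (simp add: hyp_form_commute)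

text \<open>
  Two maximal isotropic subspaces that meet in codimension one cannot both be complements of
  the isotropic subspace spanned by the last \<open>l\<close> unit vectors: both would be graphs of
  skew maps, and the difference of these would be skew of rank one.
\<close>

lemma isotropic_leading_minors:
  fixes A C :: "complex mat" and x :: "complex vec"
  assumes A: "A \<in> carrier_mat (2 * l) l" and C: "C \<in> carrier_mat l (l - 1)"
    and x: "x \<in> carrier_vec (2 * l)" and l: "l > 0"
    and iso_A: "\<And>u v. u \<in> carrier_vec l \<Longrightarrow> v \<in> carrier_vec l \<Longrightarrow>
      hyp_form l (A *\<^sub>v u) (A *\<^sub>v v) = 0"
    and iso_AC: "\<And>y. y \<in> carrier_vec (l - 1) \<Longrightarrow> hyp_form l (A *\<^sub>v (C *\<^sub>v y)) x = 0"
    and iso_x: "hyp_form l x x = 0"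
    and x_notin: "\<And>u. u \<in> carrier_vec l \<Longrightarrow> x = A *\<^sub>v u \<Longrightarrow> x = 0\<^sub>v (2 * l)"
  shows "det (mat l l (\<lambda>(r, c). A $$ (r, c))) *
    det (mat l l (\<lambda>(r, c). if c < l - 1 then (A * C) $$ (r, c) else x $ r)) = 0"
    (is "det ?P * det ?P' = 0")
proof (rule ccontr)
  assume "det ?P * det ?P' \<noteq> 0"
  then have dP: "det ?P \<noteq> 0" and dP': "det ?P' \<noteq> 0" by auto
  obtain u where u: "u \<in> carrier_vec l" and Pu: "?P *\<^sub>v u = vec l (\<lambda>k. x $ k)"
    by (rule det_nonzero_mult_mat_vec_surj[OF mat_carrier dP vec_carrier])
  define z where "z = x - A *\<^sub>v u"
  have zc: "z \<in> carrier_vec (2 * l)" and Auc: "A *\<^sub>v u \<in> carrier_vec (2 * l)"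
    using A u x by (auto simp: z_def)
  have x_eq: "x = z + A *\<^sub>v u"
    using A x Auc by (intro eq_vecI) (auto simp: z_def)
  have z_top: "z $ k = 0" if "k < l" for k
  proof -
    have "(A *\<^sub>v u) $ k = (\<Sum>j<l. A $$ (k, j) * u $ j)"
      using index_mult_mat_vec_sum[OF A u] that by simp
    also have "\<dots> = (?P *\<^sub>v u) $ k"
      using index_mult_mat_vec_sum[OF _ u, of ?P l k] that by simp
    also have "\<dots> = x $ k"
      unfolding Pu using that by simp
    finally show ?thesis
      using that A x Auc by (simp add: z_def)
  qed
  have form_z: "hyp_form l w z = (\<Sum>k<l. w $ k * z $ (l + k))" for w
    by (simp add: hyp_form_def z_top)
  have zz: "hyp_form l z z = 0"
    by (simp add: form_z z_top)
  have "hyp_form l x x = hyp_form l z z + 2 * hyp_form l (A *\<^sub>v u) z + hyp_form l (A *\<^sub>v u) (A *\<^sub>v u)"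
    using zc Auc unfolding x_eq
    by (simp add: hyp_form_add_left hyp_form_add_right hyp_form_commute)
  then have Auz: "hyp_form l (A *\<^sub>v u) z = 0"
    using iso_x zz iso_A[OF u u] by simp
  then have xz: "hyp_form l x z = 0"
    using zc Auc zz by (subst x_eq) (simp add: hyp_form_add_left)
  have ACz: "hyp_form l (A *\<^sub>v (C *\<^sub>v y)) z = 0" if y: "y \<in> carrier_vec (l - 1)" for y
  proof -
    have "C *\<^sub>v y \<in> carrier_vec l" using C y by simp
    then show ?thesis
      using iso_AC[OF y] iso_A[OF _ u, of "C *\<^sub>v y"] zc Auc
      by (subst (asm) x_eq) (simp add: hyp_form_add_right)
  qed
  define b where "b = vec l (\<lambda>k. z $ (l + k))"
  have b: "b \<in> carrier_vec l" by (simp add: b_def)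
  have "transpose_mat ?P' *\<^sub>v b = 0\<^sub>v l"
  proof (rule eq_vecI)
    fix c assume "c < dim_vec (0\<^sub>v l :: complex vec)"
    then have c: "c < l" by simp
    have "(transpose_mat ?P' *\<^sub>v b) $ c = (\<Sum>k<l. ?P' $$ (k, c) * z $ (l + k))"
      using index_mult_mat_vec_sum[of "transpose_mat ?P'" l l b c] c b
      by (auto simp: b_def)
    also have "\<dots> = 0"
    proof (cases "c < l - 1")
      case True
      have "A *\<^sub>v (C *\<^sub>v unit_vec (l - 1) c) = (A * C) *\<^sub>v unit_vec (l - 1) c"
        using A C by simp
      also have "\<dots> = col (A * C) c"
        using A C True by (intro mult_unit_vec_col) auto
      finally have "hyp_form l (col (A * C) c) z = 0"
        using ACz[of "unit_vec (l - 1) c"] by simp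
      moreover have "col (A * C) c $ k = ?P' $$ (k, c)" if "k < l" for k
        using A C that True c by simp
      ultimately show ?thesis
        by (simp add: form_z)
    next
      case False
      then show ?thesis
        using xz c by (simp add: form_z)
    qed
    finally show "(transpose_mat ?P' *\<^sub>v b) $ c = 0\<^sub>v l $ c"
      using c by simp
  qed simp
  then have "b = 0\<^sub>v l"
    using det_nonzero_mult_mat_vec_eq_0[of "transpose_mat ?P'" l b] dP' b
    by (simp add: det_transpose[of _ l])
  then have z_bot: "z $ (l + k) = 0" if "k < l" for k
    using that by (metis b_def index_vec index_zero_vec(1))
  have "z = 0\<^sub>v (2 * l)"
  proof (rule eq_vecI)
    fix k assume "k < dim_vec (0\<^sub>v (2 * l) :: complex vec)"
    then show "z $ k = 0\<^sub>v (2 * l) $ k"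
      using z_top[of k] z_bot[of "k - l"] by (cases "k < l") auto
  qed (use zc in simp)
  then have "x = A *\<^sub>v u"
    using x_eq Auc by simp
  then have x0: "x = 0\<^sub>v (2 * l)"
    using x_notin u by simp
  have "?P' *\<^sub>v unit_vec l (l - 1) = col ?P' (l - 1)"
    using l by (intro mult_unit_vec_col) auto
  also have "\<dots> = 0\<^sub>v l"
    using l x0 by (intro eq_vecI) auto
  finally have "unit_vec l (l - 1) = (0\<^sub>v l :: complex vec)"
    using det_nonzero_mult_mat_vec_eq_0[OF _ dP'] by simp
  then show False
    using arg_cong[of "unit_vec l (l - 1)" "0\<^sub>v l :: complex vec" "\<lambda>v. v $ (l - 1)"] l by simp
qed

section \<open>Polynomial functions and closures\<close>

lemma rep_polys_sum:
  assumes "\<And>i. i \<in> I \<Longrightarrow> (\<lambda>R. f i R) \<in> rep_polys Q d"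
  shows "(\<lambda>R. \<Sum>i\<in>I. f i R) \<in> rep_polys Q d"
  using assms by (induction I rule: infinite_finite_induct) (auto intro: rep_polys.intros)

lemma rep_polys_prod:
  assumes "\<And>i. i \<in> I \<Longrightarrow> (\<lambda>R. f i R) \<in> rep_polys Q d"
  shows "(\<lambda>R. \<Prod>i\<in>I. f i R) \<in> rep_polys Q d"
  using assms by (induction I rule: infinite_finite_induct) (auto intro: rep_polys.intros)

lemma rep_polys_det:
  assumes "\<And>i j. i < n \<Longrightarrow> j < n \<Longrightarrow> (\<lambda>R. f R (i, j)) \<in> rep_polys Q d"
  shows "(\<lambda>R. det (mat n n (f R))) \<in> rep_polys Q d"
proof -
  have "det (mat n n (f R)) =
      (\<Sum>p | p permutes {0..<n}. signof p * (\<Prod>i = 0..<n. f R (i, p i)))" for R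
    by (auto simp: det_def permutes_in_image intro!: sum.cong prod.cong)
  moreover have "(\<lambda>R. \<Sum>p | p permutes {0..<n}. signof p * (\<Prod>i = 0..<n. f R (i, p i))) \<in> rep_polys Q d"
    using assms
    by (intro rep_polys_sum rep_polys.mult rep_polys.const rep_polys_prod)
      (auto simp: permutes_in_image)
  ultimately show ?thesis by presburger
qed

lemma rep_polys_path_continuous:
  fixes R :: "complex \<Rightarrow> 'a \<Rightarrow> complex mat"
  assumes "p \<in> rep_polys Q d"
    and "\<And>\<alpha> r s. \<alpha> \<in> arcs Q \<Longrightarrow> r < d (head Q \<alpha>) \<Longrightarrow> s < d (tail Q \<alpha>) \<Longrightarrow>
      isCont (\<lambda>t. R t \<alpha> $$ (r, s)) t0"
  shows "isCont (\<lambda>t. p (R t)) t0"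
  using assms by induction (auto intro!: continuous_intros)

lemma limit_in_zariski_hull:
  fixes R :: "complex \<Rightarrow> 'a \<Rightarrow> complex mat"
  assumes "\<And>\<alpha> r s. \<alpha> \<in> arcs Q \<Longrightarrow> r < d (head Q \<alpha>) \<Longrightarrow> s < d (tail Q \<alpha>) \<Longrightarrow>
      isCont (\<lambda>t. R t \<alpha> $$ (r, s)) 0"
    and "\<And>t. t \<noteq> 0 \<Longrightarrow> R t \<in> S" and "R 0 \<in> rep_variety Q d"
  shows "R 0 \<in> zariski_closed Q d hull S"
  unfolding hull_def
proof (rule InterI, clarify)
  fix Z assume "zariski_closed Q d Z" and SZ: "S \<subseteq> Z"
  then obtain P where P: "P \<subseteq> rep_polys Q d" and Z: "Z = {M \<in> rep_variety Q d. \<forall>p\<in>P. p M = 0}"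
    unfolding zariski_closed_def by auto
  have "p (R 0) = 0" if p: "p \<in> P" for p
  proof (rule LIM_unique)
    show "(\<lambda>t. p (R t)) \<midarrow>0\<rightarrow> p (R 0)"
      using rep_polys_path_continuous[where p = p and R = R and ?t0.0 = 0] p P assms(1) by (auto simp: isCont_def)
    have "p (R t) = 0" if "t \<noteq> 0" for t
      using assms(2)[OF that] SZ Z p by auto
    then show "(\<lambda>t. p (R t)) \<midarrow>0\<rightarrow> 0"
      by (auto intro!: tendsto_eventually simp: eventually_at_filter)
  qed
  then show "R 0 \<in> Z"
    using assms(3) Z by auto
qed

lemma rep_act_eqI:
  assumes g: "g \<in> GL_graded Q d" and M: "M \<in> rep_space Q d" and R: "R \<in> rep_space Q d"
    and vt: "\<And>\<alpha>. \<alpha> \<in> arcs Q \<Longrightarrow> head Q \<alpha> \<in> verts Q \<and> tail Q \<alpha> \<in> verts Q"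
    and eq: "\<And>\<alpha>. \<alpha> \<in> arcs Q \<Longrightarrow> g (head Q \<alpha>) * M \<alpha> = R \<alpha> * g (tail Q \<alpha>)"
  shows "rep_act Q d g M = R"
proof
  fix \<alpha>
  show "rep_act Q d g M \<alpha> = R \<alpha>"
  proof (cases "\<alpha> \<in> arcs Q")
    case True
    let ?t = "tail Q \<alpha>"
    have u: "g ?t \<in> Units (ring_mat TYPE(complex) (d ?t) ())"
      using g vt[OF True] by (auto simp: GL_graded_def)
    have Ra: "R \<alpha> \<in> carrier_mat (d (head Q \<alpha>)) (d ?t)"
      using R True by (auto simp: rep_space_def)
    show ?thesis
      using True Ra Units_ring_mat_inv[OF u]
      by (simp add: rep_act_def eq)
  next
    case False
    then show ?thesis
      using R by (auto simp: rep_act_def rep_space_def PiE_def extensional_def)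
  qed
qed

section \<open>Symmetric representations of the Seesaw quiver\<close>

lemma seesaw_simps [simp]:
  "verts (seesaw l) = Vtx ` {1..l} \<union> {Omega} \<union> VtxS ` {1..l}"
  "arcs (seesaw l) = Arr ` {1..l} \<union> {Gamma} \<union> ArrS ` {1..l}"
  "tail (seesaw l) = seesaw_tail l" "head (seesaw l) = seesaw_head l"
  "zero_paths (seesaw l) = {[Gamma, Gamma], [ArrS l, Arr l]}"
  "vdual (seesaw l) = seesaw_vdual"
  by (simp_all add: seesaw_def)

lemma seesaw_ends:
  assumes "\<alpha> \<in> arcs (seesaw l)"
  shows "head (seesaw l) \<alpha> \<in> verts (seesaw l) \<and> tail (seesaw l) \<alpha> \<in> verts (seesaw l)"
  using assms by auto

lemma seesaw_maps_carrier:
  assumes "X \<in> carrier_mat (2 * l) (2 * l)"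
  shows "seesaw_maps l X \<alpha> \<in>
    carrier_mat (seesaw_dim l (seesaw_head l \<alpha>)) (seesaw_dim l (seesaw_tail l \<alpha>))"
  using assms by (cases \<alpha>) auto

lemma seesaw_rep_space:
  assumes "X \<in> carrier_mat (2 * l) (2 * l)"
  shows "restrict (seesaw_maps l X) (arcs (seesaw l)) \<in> rep_space (seesaw l) (seesaw_dim l)"
  using seesaw_maps_carrier[OF assms]
  by (simp only: rep_space_def restrict_PiE_iff seesaw_simps ball_simps) simp

lemma graded_space_seesawD:
  assumes "v \<in> graded_space (seesaw l) (seesaw_dim l)"
  shows "i \<in> {1..l} \<Longrightarrow> v (Vtx i) \<in> carrier_vec i" "v Omega \<in> carrier_vec (2 * l)"
    "i \<in> {1..l} \<Longrightarrow> v (VtxS i) \<in> carrier_vec i"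
proof -
  have "v j \<in> carrier_vec (seesaw_dim l j)" if "j \<in> verts (seesaw l)" for j
    using assms that unfolding graded_space_def by (rule PiE_mem)
  from this[of "Vtx i"] this[of Omega] this[of "VtxS i"]
  show "i \<in> {1..l} \<Longrightarrow> v (Vtx i) \<in> carrier_vec i" "v Omega \<in> carrier_vec (2 * l)"
    "i \<in> {1..l} \<Longrightarrow> v (VtxS i) \<in> carrier_vec i"
    by auto
qed

lemma seesaw_form_hyp_form:
  "seesaw_form l v w =
     (\<Sum>i=1..l. \<Sum>k<i. v (Vtx i) $ k * w (VtxS i) $ k + v (VtxS i) $ k * w (Vtx i) $ k) +
     hyp_form l (v Omega) (w Omega)"
  by (simp add: seesaw_form_def hyp_form_def)

lemma Arr_map_index:
  assumes "v \<in> carrier_vec i" "i \<le> l" "r < (if i = l then 2 * l else i + 1)"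
  shows "(seesaw_maps l X (Arr i) *\<^sub>v v) $ r = (if r < i then v $ r else 0)"
proof -
  have "(seesaw_maps l X (Arr i) *\<^sub>v v) $ r = (\<Sum>k<i. seesaw_maps l X (Arr i) $$ (r, k) * v $ k)"
    using assms by (intro index_mult_mat_vec_sum) auto
  also have "\<dots> = (\<Sum>k<i. if r = k then v $ k else 0)"
    using assms by (intro sum.cong) auto
  finally show ?thesis by simp
qed

lemma ArrS_map_index:
  assumes "v \<in> carrier_vec (if i = l then 2 * l else i + 1)" "i \<le> l" "r < i"
  shows "(seesaw_maps l X (ArrS i) *\<^sub>v v) $ r = - v $ (if i = l then l + r else r)"
proof -
  let ?n = "if i = l then 2 * l else i + 1"
  have "(seesaw_maps l X (ArrS i) *\<^sub>v v) $ r = (\<Sum>k<?n. seesaw_maps l X (ArrS i) $$ (r, k) * v $ k)"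
    using assms by (intro index_mult_mat_vec_sum[where nr = i]) auto
  also have "\<dots> = (\<Sum>k<?n. if (if i = l then l + r else r) = k then - v $ k else 0)"
    using assms by (intro sum.cong) auto
  finally show ?thesis using assms(3) by simp
qed

lemma rep_endo_seesaw:
  assumes l: "l \<ge> 1" and X: "X \<in> carrier_mat (2 * l) (2 * l)"
    and v: "v \<in> graded_space (seesaw l) (seesaw_dim l)"
  defines "e \<equiv> rep_endo (seesaw l) (seesaw_dim l) (restrict (seesaw_maps l X) (arcs (seesaw l))) v"
  shows "i \<in> {1..l} \<Longrightarrow> k < i \<Longrightarrow> e (Vtx i) $ k = (if k < i - 1 then v (Vtx (i - 1)) $ k else 0)"
    and "i \<in> {1..l} \<Longrightarrow> k < i \<Longrightarrow>
      e (VtxS i) $ k = - (if i = l then v Omega $ (l + k) else v (VtxS (i + 1)) $ k)"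
    and "e Omega = vec (2 * l) (\<lambda>k. if k < l then v (Vtx l) $ k else 0) + X *\<^sub>v v Omega"
proof -
  note vc = graded_space_seesawD[OF v]
  let ?in = "\<lambda>j. {\<alpha> \<in> arcs (seesaw l). head (seesaw l) \<alpha> = j}"
  have e: "e j $ k = (\<Sum>\<alpha>\<in>?in j. (seesaw_maps l X \<alpha> *\<^sub>v v (seesaw_tail l \<alpha>)) $ k)"
    if "j \<in> verts (seesaw l)" "k < seesaw_dim l j" for j k
    using that unfolding e_def rep_endo_def by (auto intro!: sum.cong)
  show "e (Vtx i) $ k = (if k < i - 1 then v (Vtx (i - 1)) $ k else 0)" if i: "i \<in> {1..l}" "k < i"
  proof (cases "i = 1")
    case True
    then have none: "?in (Vtx i) = {}"
      by (auto split: if_splits)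
    have "e (Vtx i) $ k = 0"
      using e[of "Vtx i" k, unfolded none] i by simp
    then show ?thesis
      using True by simp
  next
    case False
    then have "Arr (i - 1) \<in> Arr ` {1..l}"
      using i by (intro imageI) auto
    then have one: "?in (Vtx i) = {Arr (i - 1)}"
      using i False by (auto split: if_splits)
    have "e (Vtx i) $ k = (seesaw_maps l X (Arr (i - 1)) *\<^sub>v v (Vtx (i - 1))) $ k"
      using e[of "Vtx i" k, unfolded one] i by (simp del: seesaw_maps.simps)
    also have "\<dots> = (if k < i - 1 then v (Vtx (i - 1)) $ k else 0)"
      using i False by (intro Arr_map_index vc(1)) auto
    finally show ?thesis .
  qed
  show "e (VtxS i) $ k = - (if i = l then v Omega $ (l + k) else v (VtxS (i + 1)) $ k)"
    if i: "i \<in> {1..l}" "k < i"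
  proof -
    have one: "?in (VtxS i) = {ArrS i}"
      using i by (auto split: if_splits)
    have "e (VtxS i) $ k = (seesaw_maps l X (ArrS i) *\<^sub>v v (seesaw_tail l (ArrS i))) $ k"
      using e[of "VtxS i" k, unfolded one] i by (simp del: seesaw_maps.simps)
    also have "\<dots> = - v (seesaw_tail l (ArrS i)) $ (if i = l then l + k else k)"
      using i vc(2) vc(3)[of "i + 1"] by (intro ArrS_map_index) auto
    finally show ?thesis
      by simp
  qed
  have in_Omega: "?in Omega = {Arr l, Gamma}"
    using l by (auto split: if_splits)
  show "e Omega = vec (2 * l) (\<lambda>k. if k < l then v (Vtx l) $ k else 0) + X *\<^sub>v v Omega"
  proof (rule eq_vecI)
    fix k assume "k < dim_vec (vec (2 * l) (\<lambda>k. if k < l then v (Vtx l) $ k else 0) + X *\<^sub>v v Omega)"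
    then have k: "k < 2 * l" using X by simp
    have "e Omega $ k = (seesaw_maps l X (Arr l) *\<^sub>v v (Vtx l)) $ k + (X *\<^sub>v v Omega) $ k"
      using e[of Omega k, unfolded in_Omega] k by (simp del: seesaw_maps.simps(1))
    also have "(seesaw_maps l X (Arr l) *\<^sub>v v (Vtx l)) $ k = (if k < l then v (Vtx l) $ k else 0)"
      using k l by (intro Arr_map_index vc(1)) auto
    finally show "e Omega $ k = (vec (2 * l) (\<lambda>k. if k < l then v (Vtx l) $ k else 0) + X *\<^sub>v v Omega) $ k"
      using k X by simp
  qed (simp add: e_def rep_endo_def carrier_matD[OF X] del: seesaw_simps(2))
qed

lemma seesaw_rep_sym:
  assumes l: "l \<ge> 1" and X: "X \<in> carrier_mat (2 * l) (2 * l)"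
    and sq: "X * X = 0\<^sub>m (2 * l) (2 * l)"
    and skew: "\<And>v w. v \<in> carrier_vec (2 * l) \<Longrightarrow> w \<in> carrier_vec (2 * l) \<Longrightarrow>
      hyp_form l (X *\<^sub>v v) w + hyp_form l v (X *\<^sub>v w) = 0"
  shows "restrict (seesaw_maps l X) (arcs (seesaw l)) \<in>
    sym_rep_variety (seesaw l) (seesaw_dim l) (seesaw_form l)"
proof -
  let ?R = "restrict (seesaw_maps l X) (arcs (seesaw l))"
  let ?e = "rep_endo (seesaw l) (seesaw_dim l) ?R"
  let ?S = "graded_space (seesaw l) (seesaw_dim l)"
  have "seesaw_maps l X (ArrS l) * seesaw_maps l X (Arr l) = 0\<^sub>m l l"
  proof (rule eq_matI)
    fix r c assume "r < dim_row (0\<^sub>m l l :: complex mat)" "c < dim_col (0\<^sub>m l l :: complex mat)"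
    then show "(seesaw_maps l X (ArrS l) * seesaw_maps l X (Arr l)) $$ (r, c) = 0\<^sub>m l l $$ (r, c)"
      by (subst index_mult_mat_sum[of _ l "2 * l" _ l]) (auto intro!: sum.neutral)
  qed auto
  then have var: "?R \<in> rep_variety (seesaw l) (seesaw_dim l)"
    using l sq seesaw_rep_space[OF X] by (simp add: rep_variety_def)
  have half: "(\<Sum>i=1..l. \<Sum>k<i. ?e v (Vtx i) $ k * w (VtxS i) $ k + v (Vtx i) $ k * ?e w (VtxS i) $ k) =
      - (\<Sum>k<l. v (Vtx l) $ k * w Omega $ (l + k))" if v: "v \<in> ?S" and w: "w \<in> ?S" for v w
  proof -
    define T where "T i = (\<Sum>k<i. v (Vtx i) $ k *
      (if i = l then w Omega $ (l + k) else w (VtxS (i + 1)) $ k))" for i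
    have "(\<Sum>k<i. ?e v (Vtx i) $ k * w (VtxS i) $ k) = T (i - 1)" if "i \<in> {Suc 0..l}" for i
    proof -
      have "(\<Sum>k<i. ?e v (Vtx i) $ k * w (VtxS i) $ k) =
          (\<Sum>k<i - 1. v (Vtx (i - 1)) $ k * w (VtxS i) $ k)"
        using rep_endo_seesaw(1)[OF l X v, of i] that
        by (intro sum.mono_neutral_cong_right) auto
      also have "\<dots> = T (i - 1)"
        using that unfolding T_def by (intro sum.cong) auto
      finally show ?thesis .
    qed
    moreover have "(\<Sum>k<i. v (Vtx i) $ k * ?e w (VtxS i) $ k) = - T i" if "i \<in> {Suc 0..l}" for i
      using rep_endo_seesaw(2)[OF l X w, of i] that
      by (auto simp: T_def sum_negf[symmetric] intro!: sum.cong)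
    ultimately have "(\<Sum>i=1..l. \<Sum>k<i. ?e v (Vtx i) $ k * w (VtxS i) $ k + v (Vtx i) $ k * ?e w (VtxS i) $ k) =
        - (\<Sum>i=Suc 0..l. T i - T (i - 1))"
      by (simp add: sum.distrib sum_negf[symmetric])
    also have "\<dots> = - T l"
      by (subst sum_telescope'') (auto simp: T_def)
    finally show ?thesis by (simp add: T_def)
  qed
  have "seesaw_form l (?e v) w + seesaw_form l v (?e w) = 0" if v: "v \<in> ?S" and w: "w \<in> ?S" for v w
  proof -
    note vc = graded_space_seesawD[OF v] and wc = graded_space_seesawD[OF w]
    have top: "hyp_form l (vec (2 * l) (\<lambda>k. if k < l then a $ k else 0)) b =
        (\<Sum>k<l. a $ k * b $ (l + k))" for a b
      by (auto simp: hyp_form_def intro!: sum.cong)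
    have "hyp_form l (?e v Omega) (w Omega) + hyp_form l (v Omega) (?e w Omega) =
        (\<Sum>k<l. v (Vtx l) $ k * w Omega $ (l + k)) + (\<Sum>k<l. w (Vtx l) $ k * v Omega $ (l + k)) +
        (hyp_form l (X *\<^sub>v v Omega) (w Omega) + hyp_form l (v Omega) (X *\<^sub>v w Omega))"
      unfolding rep_endo_seesaw(3)[OF l X v] rep_endo_seesaw(3)[OF l X w]
      using X vc wc
      by (simp add: hyp_form_add_left hyp_form_add_right top hyp_form_commute[of l "v Omega" "vec _ _"])
    also have "\<dots> = (\<Sum>k<l. v (Vtx l) $ k * w Omega $ (l + k)) + (\<Sum>k<l. w (Vtx l) $ k * v Omega $ (l + k))"
      using skew vc wc by simp
    finally have "hyp_form l (?e v Omega) (w Omega) + hyp_form l (v Omega) (?e w Omega) = \<dots>" .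
    moreover have "seesaw_form l (?e v) w + seesaw_form l v (?e w) =
        (\<Sum>i=1..l. \<Sum>k<i. ?e v (Vtx i) $ k * w (VtxS i) $ k + v (Vtx i) $ k * ?e w (VtxS i) $ k) +
        (\<Sum>i=1..l. \<Sum>k<i. ?e w (Vtx i) $ k * v (VtxS i) $ k + w (Vtx i) $ k * ?e v (VtxS i) $ k) +
        (hyp_form l (?e v Omega) (w Omega) + hyp_form l (v Omega) (?e w Omega))"
      by (simp add: seesaw_form_hyp_form sum.distrib ac_simps del: seesaw_simps)
    ultimately show ?thesis
      unfolding half[OF v w] half[OF w v] by simp
  qed
  with var show ?thesis
    by (simp add: sym_rep_variety_def)
qed

lemma M_gamma_index:
  assumes "l \<ge> 2" "v \<in> carrier_vec (2 * l)" "r < 2 * l"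
  shows "(M_gamma l *\<^sub>v v) $ r = (if r = 2 * l - 1 then v $ 0 else if r = l then - v $ (l - 1) else 0)"
proof -
  have "(M_gamma l *\<^sub>v v) $ r = (\<Sum>k<2*l. M_gamma l $$ (r, k) * v $ k)"
    using assms by (intro index_mult_mat_vec_sum) (auto simp: M_gamma_def)
  also have "\<dots> = (\<Sum>k<2*l. (if 0 = k then if r = 2 * l - 1 then v $ k else 0 else 0) +
      (if l - 1 = k then if r = l then - v $ k else 0 else 0))"
    using assms by (intro sum.cong) (auto simp: M_gamma_def)
  finally show ?thesis
    using assms by (auto simp: sum.distrib)
qed

lemma N_gamma_index:
  assumes "l \<ge> 2" "v \<in> carrier_vec (2 * l)" "r < 2 * l"
  shows "(N_gamma l *\<^sub>v v) $ r = (if r = l - 1 then v $ 0 else if r = l then - v $ (2 * l - 1) else 0)"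
proof -
  have "(N_gamma l *\<^sub>v v) $ r = (\<Sum>k<2*l. N_gamma l $$ (r, k) * v $ k)"
    using assms by (intro index_mult_mat_vec_sum) (auto simp: N_gamma_def)
  also have "\<dots> = (\<Sum>k<2*l. (if 0 = k then if r = l - 1 then v $ k else 0 else 0) +
      (if 2 * l - 1 = k then if r = l then - v $ k else 0 else 0))"
    using assms by (intro sum.cong) (auto simp: N_gamma_def)
  finally show ?thesis
    using assms by (auto simp: sum.distrib)
qed

lemma hyp_form_M_gamma:
  assumes l: "l \<ge> 2" and v: "v \<in> carrier_vec (2 * l)"
  shows "hyp_form l (M_gamma l *\<^sub>v v) w = v $ 0 * w $ (l - 1) - v $ (l - 1) * w $ 0"
proof -
  have "hyp_form l (M_gamma l *\<^sub>v v) w =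
      (\<Sum>k<l. (if l - 1 = k then v $ 0 * w $ k else 0) + (if 0 = k then - v $ (l - 1) * w $ k else 0))"
    unfolding hyp_form_def
    by (intro sum.cong) (use l M_gamma_index[OF l v] in auto)
  then show ?thesis
    using l by (simp add: sum.distrib)
qed

lemma hyp_form_N_gamma:
  assumes l: "l \<ge> 2" and v: "v \<in> carrier_vec (2 * l)"
  shows "hyp_form l (N_gamma l *\<^sub>v v) w = v $ 0 * w $ (2 * l - 1) - v $ (2 * l - 1) * w $ 0"
proof -
  have "hyp_form l (N_gamma l *\<^sub>v v) w =
      (\<Sum>k<l. (if l - 1 = k then v $ 0 * w $ (l + k) else 0) +
        (if 0 = k then - v $ (2 * l - 1) * w $ k else 0))"
    unfolding hyp_form_def
    by (intro sum.cong) (use l N_gamma_index[OF l v] in auto)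
  then show ?thesis
    using l by (simp add: sum.distrib mult_2)
qed

lemma M_rep_sym:
  assumes l: "l \<ge> 2"
  shows "M_rep l \<in> sym_rep_variety (seesaw l) (seesaw_dim l) (seesaw_form l)"
  unfolding M_rep_def
proof (rule seesaw_rep_sym)
  show "M_gamma l * M_gamma l = 0\<^sub>m (2 * l) (2 * l)"
  proof (rule eq_matI)
    fix r c assume "r < dim_row (0\<^sub>m (2 * l) (2 * l) :: complex mat)" "c < dim_col (0\<^sub>m (2 * l) (2 * l) :: complex mat)"
    then show "(M_gamma l * M_gamma l) $$ (r, c) = 0\<^sub>m (2 * l) (2 * l) $$ (r, c)"
      using l by (subst index_mult_mat_sum[of _ "2 * l" "2 * l" _ "2 * l"])
        (auto simp: M_gamma_def intro!: sum.neutral)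
  qed (auto simp: M_gamma_def)
  show "hyp_form l (M_gamma l *\<^sub>v v) w + hyp_form l v (M_gamma l *\<^sub>v w) = 0"
    if "v \<in> carrier_vec (2 * l)" "w \<in> carrier_vec (2 * l)" for v w
    using hyp_form_M_gamma[OF l] that by (simp add: hyp_form_commute[of l v])
qed (use l in \<open>auto simp: M_gamma_def\<close>)

lemma N_rep_sym:
  assumes l: "l \<ge> 2"
  shows "N_rep l \<in> sym_rep_variety (seesaw l) (seesaw_dim l) (seesaw_form l)"
  unfolding N_rep_def
proof (rule seesaw_rep_sym)
  show "N_gamma l * N_gamma l = 0\<^sub>m (2 * l) (2 * l)"
  proof (rule eq_matI)
    fix r c assume "r < dim_row (0\<^sub>m (2 * l) (2 * l) :: complex mat)" "c < dim_col (0\<^sub>m (2 * l) (2 * l) :: complex mat)"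
    then show "(N_gamma l * N_gamma l) $$ (r, c) = 0\<^sub>m (2 * l) (2 * l) $$ (r, c)"
      using l by (subst index_mult_mat_sum[of _ "2 * l" "2 * l" _ "2 * l"])
        (auto simp: N_gamma_def intro!: sum.neutral)
  qed (auto simp: N_gamma_def)
  show "hyp_form l (N_gamma l *\<^sub>v v) w + hyp_form l v (N_gamma l *\<^sub>v w) = 0"
    if "v \<in> carrier_vec (2 * l)" "w \<in> carrier_vec (2 * l)" for v w
    using hyp_form_N_gamma[OF l] that by (simp add: hyp_form_commute[of l v])
qed (use l in \<open>auto simp: N_gamma_def\<close>)

lemma seesaw_form_commute: "seesaw_form l v w = seesaw_form l w v"
  by (simp add: seesaw_form_def algebra_simps)

lemma seesaw_form_lin:
  assumes "u \<in> graded_space (seesaw l) (seesaw_dim l)" "v \<in> graded_space (seesaw l) (seesaw_dim l)"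
  shows "seesaw_form l (\<lambda>i\<in>verts (seesaw l). a \<cdot>\<^sub>v u i + b \<cdot>\<^sub>v v i) w =
    a * seesaw_form l u w + b * seesaw_form l v w"
proof -
  note uc = graded_space_seesawD[OF assms(1)] and vc = graded_space_seesawD[OF assms(2)]
  have "(\<Sum>k<l. ((a \<cdot>\<^sub>v u Omega + b \<cdot>\<^sub>v v Omega) $ k) * w Omega $ (l + k) +
      ((a \<cdot>\<^sub>v u Omega + b \<cdot>\<^sub>v v Omega) $ (l + k)) * w Omega $ k) =
      a * (\<Sum>k<l. u Omega $ k * w Omega $ (l + k) + u Omega $ (l + k) * w Omega $ k) +
      b * (\<Sum>k<l. v Omega $ k * w Omega $ (l + k) + v Omega $ (l + k) * w Omega $ k)"
    unfolding sum_distrib_left sum.distrib[symmetric]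
    by (intro sum.cong) (use uc(2) vc(2) in \<open>auto simp: algebra_simps\<close>)
  moreover have "(\<Sum>i=1..l. \<Sum>k<i. (a \<cdot>\<^sub>v u (Vtx i) + b \<cdot>\<^sub>v v (Vtx i)) $ k * w (VtxS i) $ k +
      (a \<cdot>\<^sub>v u (VtxS i) + b \<cdot>\<^sub>v v (VtxS i)) $ k * w (Vtx i) $ k) =
      a * (\<Sum>i=1..l. \<Sum>k<i. u (Vtx i) $ k * w (VtxS i) $ k + u (VtxS i) $ k * w (Vtx i) $ k) +
      b * (\<Sum>i=1..l. \<Sum>k<i. v (Vtx i) $ k * w (VtxS i) $ k + v (VtxS i) $ k * w (Vtx i) $ k)"
    unfolding sum_distrib_left sum.distrib[symmetric]
  proof (intro sum.cong refl)
    fix i k assume i: "i \<in> {1..l}" and k: "k \<in> {..<i}"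
    show "(a \<cdot>\<^sub>v u (Vtx i) + b \<cdot>\<^sub>v v (Vtx i)) $ k * w (VtxS i) $ k +
      (a \<cdot>\<^sub>v u (VtxS i) + b \<cdot>\<^sub>v v (VtxS i)) $ k * w (Vtx i) $ k =
      a * (u (Vtx i) $ k * w (VtxS i) $ k + u (VtxS i) $ k * w (Vtx i) $ k) +
      b * (v (Vtx i) $ k * w (VtxS i) $ k + v (VtxS i) $ k * w (Vtx i) $ k)"
      using uc(1,3)[OF i] vc(1,3)[OF i] k by (auto simp: algebra_simps)
  qed
  ultimately show ?thesis
    by (simp add: seesaw_form_def algebra_simps)
qed

definition graded_unit :: "nat \<Rightarrow> seesaw_vertex \<Rightarrow> nat \<Rightarrow> seesaw_vertex \<Rightarrow> complex vec" where
  "graded_unit l j k = (\<lambda>i\<in>verts (seesaw l).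
     if i = j then unit_vec (seesaw_dim l i) k else 0\<^sub>v (seesaw_dim l i))"

lemma graded_unit_in: "graded_unit l j k \<in> graded_space (seesaw l) (seesaw_dim l)"
  by (auto simp: graded_unit_def graded_space_def)

lemma seesaw_form_graded_unit:
  shows "i \<in> {1..l} \<Longrightarrow> k < i \<Longrightarrow> seesaw_form l v (graded_unit l (Vtx i) k) = v (VtxS i) $ k"
    and "i \<in> {1..l} \<Longrightarrow> k < i \<Longrightarrow> seesaw_form l v (graded_unit l (VtxS i) k) = v (Vtx i) $ k"
    and "k < 2 * l \<Longrightarrow> seesaw_form l v (graded_unit l Omega k) = v Omega $ (if k < l then l + k else k - l)"
proof -
  assume i: "i \<in> {1..l}" and k: "k < i"
  have "(\<Sum>k'<i'. v (Vtx i') $ k' * graded_unit l (Vtx i) k (VtxS i') $ k' + v (VtxS i') $ k' * graded_unit l (Vtx i) k (Vtx i') $ k') =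
      (if i = i' then v (VtxS i) $ k else 0)" if "i' \<in> {1..l}" for i'
  proof -
    have "(\<Sum>k'<i'. v (Vtx i') $ k' * graded_unit l (Vtx i) k (VtxS i') $ k' + v (VtxS i') $ k' * graded_unit l (Vtx i) k (Vtx i') $ k') =
        (\<Sum>k'<i'. if k = k' then if i = i' then v (VtxS i) $ k else 0 else 0)"
      by (intro sum.cong) (use that k in \<open>auto simp: graded_unit_def\<close>)
    then show ?thesis using k by simp
  qed
  moreover have "graded_unit l (Vtx i) k Omega = 0\<^sub>v (2 * l)"
    by (simp add: graded_unit_def)
  ultimately have "seesaw_form l v (graded_unit l (Vtx i) k) =
      (\<Sum>i'=1..l. if i = i' then v (VtxS i) $ k else 0)"
    unfolding seesaw_form_def by simp
  then show "seesaw_form l v (graded_unit l (Vtx i) k) = v (VtxS i) $ k"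
    using i k by simp
  have "(\<Sum>k'<i'. v (Vtx i') $ k' * graded_unit l (VtxS i) k (VtxS i') $ k' + v (VtxS i') $ k' * graded_unit l (VtxS i) k (Vtx i') $ k') =
      (if i = i' then v (Vtx i) $ k else 0)" if "i' \<in> {1..l}" for i'
  proof -
    have "(\<Sum>k'<i'. v (Vtx i') $ k' * graded_unit l (VtxS i) k (VtxS i') $ k' + v (VtxS i') $ k' * graded_unit l (VtxS i) k (Vtx i') $ k') =
        (\<Sum>k'<i'. if k = k' then if i = i' then v (Vtx i) $ k else 0 else 0)"
      by (intro sum.cong) (use that k in \<open>auto simp: graded_unit_def\<close>)
    then show ?thesis using k by simp
  qed
  moreover have "graded_unit l (VtxS i) k Omega = 0\<^sub>v (2 * l)"
    by (simp add: graded_unit_def)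
  ultimately have "seesaw_form l v (graded_unit l (VtxS i) k) =
      (\<Sum>i'=1..l. if i = i' then v (Vtx i) $ k else 0)"
    unfolding seesaw_form_def by simp
  then show "seesaw_form l v (graded_unit l (VtxS i) k) = v (Vtx i) $ k"
    using i k by simp
next
  assume k: "k < 2 * l"
  have "(\<Sum>k'<l. v Omega $ k' * graded_unit l Omega k Omega $ (l + k') +
        v Omega $ (l + k') * graded_unit l Omega k Omega $ k') =
      (\<Sum>k'<l. (if k - l = k' then if k < l then 0 else v Omega $ k' else 0) +
        (if k = k' then v Omega $ (l + k') else 0))"
    by (intro sum.cong) (use k in \<open>auto simp: graded_unit_def\<close>)
  moreover have "graded_unit l Omega k (Vtx i) $ k' = 0" "graded_unit l Omega k (VtxS i) $ k' = 0"
    if "i \<in> {1..l}" "k' < i" for i k'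
    using that by (auto simp: graded_unit_def)
  ultimately have "seesaw_form l v (graded_unit l Omega k) =
      (\<Sum>k'<l. (if k - l = k' then if k < l then 0 else v Omega $ k' else 0) +
        (if k = k' then v Omega $ (l + k') else 0))"
    unfolding seesaw_form_def by simp
  then show "seesaw_form l v (graded_unit l Omega k) = v Omega $ (if k < l then l + k else k - l)"
    using k by (auto simp: sum.distrib)
qed

lemma seesaw_eps_form: "eps_form (seesaw l) (seesaw_dim l) 1 (seesaw_form l)"
  unfolding eps_form_def
proof (intro conjI ballI allI impI)
  let ?S = "graded_space (seesaw l) (seesaw_dim l)"
  fix u v w a b assume u: "u \<in> ?S" and v: "v \<in> ?S" and "w \<in> ?S"
  show "seesaw_form l (\<lambda>i\<in>verts (seesaw l). a \<cdot>\<^sub>v u i + b \<cdot>\<^sub>v v i) w =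
      a * seesaw_form l u w + b * seesaw_form l v w"
    by (rule seesaw_form_lin[OF u v])
  then show "seesaw_form l w (\<lambda>i\<in>verts (seesaw l). a \<cdot>\<^sub>v u i + b \<cdot>\<^sub>v v i) =
      a * seesaw_form l w u + b * seesaw_form l w v"
    unfolding seesaw_form_commute[of l w] .
next
  let ?S = "graded_space (seesaw l) (seesaw_dim l)"
  fix v assume v: "v \<in> ?S" and "\<forall>w\<in>?S. seesaw_form l v w = 0"
  then have z: "seesaw_form l v (graded_unit l j k) = 0" for j k
    using graded_unit_in by blast
  note vc = graded_space_seesawD[OF v]
  have 1: "v (Vtx i) = 0\<^sub>v i" "v (VtxS i) = 0\<^sub>v i" if "i \<in> {1..l}" for i
    using seesaw_form_graded_unit(1,2)[OF that, of _ v] z vc(1,3)[OF that]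
    by (auto intro!: eq_vecI)
  have 2: "v Omega = 0\<^sub>v (2 * l)"
  proof (rule eq_vecI)
    fix k assume "k < dim_vec (0\<^sub>v (2 * l) :: complex vec)"
    then have k: "k < l \<or> k - l < l \<and> l + (k - l) = k" "k < 2 * l"
      by auto
    then show "v Omega $ k = 0\<^sub>v (2 * l) $ k"
      using seesaw_form_graded_unit(3)[of "l + k" l v] seesaw_form_graded_unit(3)[of "k - l" l v] z
      by (elim disjE) auto
  qed (use vc in auto)
  have "v \<in> extensional (verts (seesaw l))"
    using v by (simp add: graded_space_def PiE_def)
  moreover have "v i = 0\<^sub>v (seesaw_dim l i)" if "i \<in> verts (seesaw l)" for i
    using that 1 2 by auto
  ultimately show "v = (\<lambda>i\<in>verts (seesaw l). 0\<^sub>v (seesaw_dim l i))"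
    by (intro extensionalityI[of _ "verts (seesaw l)"]) auto
next
  fix v w show "seesaw_form l v w = 1 * seesaw_form l w v"
    by (simp add: seesaw_form_commute)
next
  fix i j v w
  assume ij: "j \<noteq> vdual (seesaw l) i"
    and v: "v \<in> graded_part (seesaw l) (seesaw_dim l) i"
    and w: "w \<in> graded_part (seesaw l) (seesaw_dim l) j"
  have zero: "v h $ r * w h' $ r' = 0"
    if "h \<in> verts (seesaw l)" "h' = seesaw_vdual h" "r < seesaw_dim l h" "r' < seesaw_dim l h'" for h h' r r'
  proof (cases "h = i")
    case True
    have "h' \<in> verts (seesaw l)" using that by auto
    then have "w h' = 0\<^sub>v (seesaw_dim l h')"
      using w ij True that by (auto simp: graded_part_def)
    then show ?thesis using that by simp
  next
    case False
    then have "v h = 0\<^sub>v (seesaw_dim l h)"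
      using v that by (auto simp: graded_part_def)
    then show ?thesis using that by simp
  qed
  have "v (Vtx i) $ k * w (VtxS i) $ k = 0" "v (VtxS i) $ k * w (Vtx i) $ k = 0"
    if "i \<in> {1..l}" "k < i" for i k
    by (rule zero; use that in simp)+
  moreover have "v Omega $ k * w Omega $ (l + k) = 0" "v Omega $ (l + k) * w Omega $ k = 0" if "k < l" for k
    by (rule zero; use that in simp)+
  ultimately show "seesaw_form l v w = 0"
    unfolding seesaw_form_def by (simp del: mult_eq_0_iff cong: sum.cong_simp)
qed

section \<open>The degeneration\<close>

definition deg_gamma :: "nat \<Rightarrow> complex \<Rightarrow> complex mat" where
  "deg_gamma l t = mat (2 * l) (2 * l)
     (\<lambda>(r, c). if c = 0 \<and> r = l - 1 then 1
               else if c = 0 \<and> r = 2 * l - 1 then t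
               else if c = l - 1 \<and> r = l then t
               else if c = 2 * l - 1 \<and> r = l then - 1 else 0)"

text \<open>
  On \<open>V\<^sub>\<omega>\<close> this conjugates \<open>M\<^sub>\<gamma>\<close> into \<open>deg_gamma l t\<close>; the values at the starred vertices are
  then forced by compatibility with the maps along the arrows \<open>a\<^sub>i\<^sup>*\<close>.
\<close>

fun deg_elt :: "nat \<Rightarrow> complex \<Rightarrow> seesaw_vertex \<Rightarrow> complex mat" where
  "deg_elt l t (Vtx i) = 1\<^sub>m i"
| "deg_elt l t Omega = mat (2 * l) (2 * l)
     (\<lambda>(r, c). if r = c then (if c = l then - t else if c = 2 * l - 1 then t else 1)
               else if r = l - 1 \<and> c = 2 * l - 1 then 1 else 0)"
| "deg_elt l t (VtxS i) = mat i i
     (\<lambda>(r, c). if r = c then (if c = 0 then - t else if c = l - 1 then t else 1) else 0)"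

lemma deg_elt_carrier: "deg_elt l t j \<in> carrier_mat (seesaw_dim l j) (seesaw_dim l j)"
  by (cases j) auto

lemma deg_elt_unit:
  assumes "t \<noteq> 0" "l \<ge> 2"
  shows "deg_elt l t j \<in> Units (ring_mat TYPE(complex) (seesaw_dim l j) ())"
proof -
  have "upper_triangular (deg_elt l t j)"
    using assms by (cases j) (auto simp: upper_triangular_def)
  then have "det (deg_elt l t j) = prod_list (diag_mat (deg_elt l t j))"
    by (rule det_upper_triangular[OF _ deg_elt_carrier])
  also have "\<dots> \<noteq> 0"
    using assms by (cases j) (auto simp: diag_mat_def prod_list_zero_iff)
  finally show ?thesis
    by (rule det_non_zero_imp_unit[OF deg_elt_carrier])
qed

lemma deg_elt_Arr:
  assumes "i \<in> {1..l}"
  shows "deg_elt l t (seesaw_head l (Arr i)) * seesaw_maps l X (Arr i) =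
    seesaw_maps l Y (Arr i) * deg_elt l t (seesaw_tail l (Arr i))" (is "?L = ?R")
proof -
  let ?m = "seesaw_dim l (seesaw_head l (Arr i))"
  have c: "seesaw_maps l X (Arr i) \<in> carrier_mat ?m i" by simp
  have "?L = seesaw_maps l X (Arr i)"
  proof (rule eq_matI)
    fix r s assume "r < dim_row (seesaw_maps l X (Arr i))" "s < dim_col (seesaw_maps l X (Arr i))"
    then have rs: "r < ?m" "s < i" by (auto split: if_splits)
    have "?L $$ (r, s) = (\<Sum>k<?m. deg_elt l t (seesaw_head l (Arr i)) $$ (r, k) * seesaw_maps l X (Arr i) $$ (k, s))"
      by (intro index_mult_mat_sum[OF deg_elt_carrier c] rs)
    also have "\<dots> = (\<Sum>k<?m. if s = k then deg_elt l t (seesaw_head l (Arr i)) $$ (r, s) else 0)"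
      using rs by (intro sum.cong) auto
    also have "\<dots> = seesaw_maps l X (Arr i) $$ (r, s)"
      using rs assms by auto
    finally show "?L $$ (r, s) = seesaw_maps l X (Arr i) $$ (r, s)" .
  qed (use deg_elt_carrier in auto)
  then show ?thesis by simp
qed

lemma deg_elt_ArrS:
  assumes i: "i \<in> {1..l}" and l: "l \<ge> 2"
  shows "deg_elt l t (seesaw_head l (ArrS i)) * seesaw_maps l X (ArrS i) =
    seesaw_maps l Y (ArrS i) * deg_elt l t (seesaw_tail l (ArrS i))" (is "?L = ?R")
proof (rule eq_matI)
  let ?m = "seesaw_dim l (seesaw_tail l (ArrS i))"
  let ?p = "\<lambda>r. if i = l then l + r else r"
  have X: "seesaw_maps l X (ArrS i) \<in> carrier_mat i ?m" and Y: "seesaw_maps l Y (ArrS i) \<in> carrier_mat i ?m"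
    and h: "deg_elt l t (seesaw_head l (ArrS i)) \<in> carrier_mat i i"
    by auto
  fix r s assume "r < dim_row ?R" "s < dim_col ?R"
  then have rs: "r < i" "s < ?m" by (auto split: if_splits)
  have "?L $$ (r, s) = (\<Sum>k<i. deg_elt l t (VtxS i) $$ (r, k) * seesaw_maps l X (ArrS i) $$ (k, s))"
    using index_mult_mat_sum[OF h X rs] by simp
  also have "\<dots> = (\<Sum>k<i. if r = k then deg_elt l t (VtxS i) $$ (r, r) * seesaw_maps l X (ArrS i) $$ (r, s) else 0)"
    using rs by (intro sum.cong) auto
  also have "\<dots> = deg_elt l t (VtxS i) $$ (r, r) * seesaw_maps l X (ArrS i) $$ (r, s)"
    using rs by simp
  also have "\<dots> = - deg_elt l t (seesaw_tail l (ArrS i)) $$ (?p r, s)"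
    using rs l i by auto
  also have "\<dots> = (\<Sum>k<?m. if ?p r = k then - deg_elt l t (seesaw_tail l (ArrS i)) $$ (?p r, s) else 0)"
    using rs by simp
  also have "\<dots> = (\<Sum>k<?m. seesaw_maps l Y (ArrS i) $$ (r, k) * deg_elt l t (seesaw_tail l (ArrS i)) $$ (k, s))"
    using rs by (intro sum.cong) (auto simp del: deg_elt.simps)
  also have "\<dots> = ?R $$ (r, s)"
    by (rule index_mult_mat_sum[OF Y deg_elt_carrier rs, symmetric])
  finally show "?L $$ (r, s) = ?R $$ (r, s)" .
qed (use deg_elt_carrier in auto)

lemma deg_elt_Gamma:
  assumes l: "l \<ge> 2"
  shows "deg_elt l t Omega * M_gamma l = deg_gamma l t * deg_elt l t Omega" (is "?L = ?R")
proof (rule eq_matI)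
  fix r s assume "r < dim_row ?R" "s < dim_col ?R"
  then have rs: "r < 2 * l" "s < 2 * l" by (auto simp: deg_gamma_def)
  have c: "M_gamma l \<in> carrier_mat (2 * l) (2 * l)" "deg_gamma l t \<in> carrier_mat (2 * l) (2 * l)"
    "deg_elt l t Omega \<in> carrier_mat (2 * l) (2 * l)"
    by (auto simp: M_gamma_def deg_gamma_def)
  have "?L $$ (r, s) = (\<Sum>k<2*l. deg_elt l t Omega $$ (r, k) * M_gamma l $$ (k, s))"
    by (rule index_mult_mat_sum[OF c(3,1) rs])
  also have "\<dots> = (\<Sum>k<2*l. (if 2 * l - 1 = k then if s = 0 then deg_elt l t Omega $$ (r, k) else 0 else 0) +
      (if l = k then if s = l - 1 then - deg_elt l t Omega $$ (r, k) else 0 else 0))"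
    using rs l by (intro sum.cong) (auto simp: M_gamma_def simp del: deg_elt.simps)
  also have "\<dots> = (if s = 0 then deg_elt l t Omega $$ (r, 2 * l - 1) else 0) +
      (if s = l - 1 then - deg_elt l t Omega $$ (r, l) else 0)"
    using l by (simp add: sum.distrib del: deg_elt.simps)
  also have "\<dots> = deg_gamma l t $$ (r, s) * (if s = l then - t else if s = 2 * l - 1 then t else 1) +
      (if s = 2 * l - 1 then deg_gamma l t $$ (r, l - 1) else 0)"
    using rs l by (auto simp: deg_gamma_def)
  also have "\<dots> = (\<Sum>k<2*l. (if s = k then deg_gamma l t $$ (r, k) * (if s = l then - t else if s = 2 * l - 1 then t else 1) else 0) +
      (if l - 1 = k then if s = 2 * l - 1 then deg_gamma l t $$ (r, k) else 0 else 0))"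
    using rs l by (simp add: sum.distrib)
  also have "\<dots> = (\<Sum>k<2*l. deg_gamma l t $$ (r, k) * deg_elt l t Omega $$ (k, s))"
    using rs l by (intro sum.cong) auto
  also have "\<dots> = ?R $$ (r, s)"
    by (rule index_mult_mat_sum[OF c(2,3) rs, symmetric])
  finally show "?L $$ (r, s) = ?R $$ (r, s)" .
qed (auto simp: deg_gamma_def M_gamma_def)

definition deg_rep :: "nat \<Rightarrow> complex \<Rightarrow> seesaw_arrow \<Rightarrow> complex mat" where
  "deg_rep l t = restrict (seesaw_maps l (deg_gamma l t)) (arcs (seesaw l))"

lemma deg_rep_orbit:
  assumes t: "t \<noteq> 0" and l: "l \<ge> 2"
  shows "deg_rep l t \<in> (\<lambda>g. rep_act (seesaw l) (seesaw_dim l) g (M_rep l)) ` GL_graded (seesaw l) (seesaw_dim l)"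
proof -
  define g where "g = restrict (deg_elt l t) (verts (seesaw l))"
  have g: "g \<in> GL_graded (seesaw l) (seesaw_dim l)"
    using deg_elt_unit[OF t l] unfolding GL_graded_def g_def restrict_PiE_iff by blast
  have act: "rep_act (seesaw l) (seesaw_dim l) g (M_rep l) = deg_rep l t"
  proof (rule rep_act_eqI[OF g])
    fix \<alpha> assume a: "\<alpha> \<in> arcs (seesaw l)"
    have "deg_elt l t (seesaw_head l \<alpha>) * seesaw_maps l (M_gamma l) \<alpha> =
        seesaw_maps l (deg_gamma l t) \<alpha> * deg_elt l t (seesaw_tail l \<alpha>)"
    proof (cases \<alpha>)
      case (Arr i)
      then have "i \<in> {1..l}" using a by auto
      then show ?thesis unfolding Arr by (rule deg_elt_Arr)
    next
      case Gamma
      then show ?thesis using deg_elt_Gamma[OF l] by simp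
    next
      case (ArrS i)
      then have "i \<in> {1..l}" using a by auto
      then show ?thesis unfolding ArrS using l by (rule deg_elt_ArrS)
    qed
    then show "g (head (seesaw l) \<alpha>) * M_rep l \<alpha> = deg_rep l t \<alpha> * g (tail (seesaw l) \<alpha>)"
      using a seesaw_ends[OF a] unfolding g_def M_rep_def deg_rep_def by (simp only: restrict_apply' seesaw_simps(3,4))
  qed (auto simp: M_rep_def deg_rep_def M_gamma_def deg_gamma_def seesaw_ends
      intro!: seesaw_rep_space simp del: seesaw_simps)
  show ?thesis
    using g unfolding act[symmetric] by (rule imageI)
qed

lemma deg_rep_0: "l \<ge> 2 \<Longrightarrow> deg_rep l 0 = N_rep l"
proof -
  assume "l \<ge> 2"
  then have "deg_gamma l 0 = N_gamma l"
    by (intro eq_matI) (auto simp: deg_gamma_def N_gamma_def)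
  then show ?thesis by (simp add: deg_rep_def N_rep_def)
qed

lemma M_deg_N:
  assumes l: "l \<ge> 2"
  shows "deg_le (seesaw l) (seesaw_dim l) (M_rep l) (N_rep l)"
  unfolding deg_le_def deg_rep_0[OF l, symmetric]
proof (rule limit_in_zariski_hull)
  show "deg_rep l t \<in> (\<lambda>g. rep_act (seesaw l) (seesaw_dim l) g (M_rep l)) ` GL_graded (seesaw l) (seesaw_dim l)"
    if "t \<noteq> 0" for t
    using deg_rep_orbit[OF that l] .
  show "deg_rep l 0 \<in> rep_variety (seesaw l) (seesaw_dim l)"
    using N_rep_sym[OF l] by (simp add: deg_rep_0[OF l] sym_rep_variety_def)
  fix \<alpha> r s
  assume a: "\<alpha> \<in> arcs (seesaw l)" and rs: "r < seesaw_dim l (head (seesaw l) \<alpha>)" "s < seesaw_dim l (tail (seesaw l) \<alpha>)"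
  have "isCont (\<lambda>t. seesaw_maps l (deg_gamma l t) \<alpha> $$ (r, s)) 0"
  proof (cases "\<alpha> = Gamma")
    case True
    have "deg_gamma l t $$ (r, s) = N_gamma l $$ (r, s) +
        (if s = 0 \<and> r = 2 * l - 1 \<or> s = l - 1 \<and> r = l then t else 0)" for t
      using rs l True by (auto simp: deg_gamma_def N_gamma_def)
    then show ?thesis
      using True by (cases "s = 0 \<and> r = 2 * l - 1 \<or> s = l - 1 \<and> r = l") (simp_all del: de_Morgan_disj de_Morgan_conj)
  next
    case False
    then have "(\<lambda>t. seesaw_maps l (deg_gamma l t) \<alpha> $$ (r, s)) =
        (\<lambda>t. seesaw_maps l (N_gamma l) \<alpha> $$ (r, s))"
      by (cases \<alpha>) auto
    then show ?thesis by (simp only: continuous_const)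
  qed
  then show "isCont (\<lambda>t. deg_rep l t \<alpha> $$ (r, s)) 0"
    using a by (simp add: deg_rep_def del: seesaw_simps)
qed

lemma seesaw_rep_act_variety:
  assumes g: "g \<in> GL_graded (seesaw l) (seesaw_dim l)" and R: "R \<in> rep_variety (seesaw l) (seesaw_dim l)"
    and l: "l \<ge> 1"
  shows "rep_act (seesaw l) (seesaw_dim l) g R \<in> rep_variety (seesaw l) (seesaw_dim l)"
proof -
  define G where "G j = (let n = seesaw_dim l j in m_inv (ring_mat TYPE(complex) n ()) (g j))" for j
  have u: "g j \<in> Units (ring_mat TYPE(complex) (seesaw_dim l j) ())" if "j \<in> verts (seesaw l)" for j
    using g that unfolding GL_graded_def by (rule PiE_mem)
  note gc = Units_ring_mat_inv(1)[OF u] and Gc = Units_ring_mat_inv(2)[OF u, folded G_def[unfolded Let_def]]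
    and Gg = Units_ring_mat_inv(3)[OF u, folded G_def[unfolded Let_def]]
  have Rc: "R \<alpha> \<in> carrier_mat (seesaw_dim l (head (seesaw l) \<alpha>)) (seesaw_dim l (tail (seesaw l) \<alpha>))"
    if "\<alpha> \<in> arcs (seesaw l)" for \<alpha>
    using R that unfolding rep_variety_def rep_space_def by (auto dest: PiE_mem simp del: seesaw_simps)
  let ?A = "rep_act (seesaw l) (seesaw_dim l) g R"
  have act: "?A \<alpha> = g (head (seesaw l) \<alpha>) * R \<alpha> * G (tail (seesaw l) \<alpha>)" if "\<alpha> \<in> arcs (seesaw l)" for \<alpha>
    using that unfolding rep_act_def G_def Let_def by (rule restrict_apply')
  have sp: "?A \<in> rep_space (seesaw l) (seesaw_dim l)"
  proof -
    have "?A \<alpha> \<in> carrier_mat (seesaw_dim l (head (seesaw l) \<alpha>)) (seesaw_dim l (tail (seesaw l) \<alpha>))"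
      if a: "\<alpha> \<in> arcs (seesaw l)" for \<alpha>
      unfolding act[OF a] using gc Gc Rc[OF a] seesaw_ends[OF a] by (intro mult_carrier_mat) auto
    moreover have "?A \<in> extensional (arcs (seesaw l))"
      unfolding rep_act_def by (rule restrict_extensional)
    ultimately show ?thesis
      unfolding rep_space_def by (simp add: PiE_def Pi_def del: seesaw_simps)
  qed
  have comp: "?A \<alpha> * ?A \<beta> = 0\<^sub>m (seesaw_dim l (head (seesaw l) \<alpha>)) (seesaw_dim l (tail (seesaw l) \<beta>))"
    if a: "\<alpha> \<in> arcs (seesaw l)" and b: "\<beta> \<in> arcs (seesaw l)" and ab: "tail (seesaw l) \<alpha> = head (seesaw l) \<beta>"
      and z: "R \<alpha> * R \<beta> = 0\<^sub>m (seesaw_dim l (head (seesaw l) \<alpha>)) (seesaw_dim l (tail (seesaw l) \<beta>))" for \<alpha> \<beta>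
  proof -
    define h m t where "h = head (seesaw l) \<alpha>" and "m = head (seesaw l) \<beta>" and "t = tail (seesaw l) \<beta>"
    let ?d = "seesaw_dim l"
    have v: "h \<in> verts (seesaw l)" "m \<in> verts (seesaw l)" "t \<in> verts (seesaw l)"
      using seesaw_ends[OF a] seesaw_ends[OF b] by (auto simp: h_def m_def t_def simp del: seesaw_simps)
    have Ra: "R \<alpha> \<in> carrier_mat (?d h) (?d m)" and Rb: "R \<beta> \<in> carrier_mat (?d m) (?d t)"
      using Rc[OF a] Rc[OF b] ab by (auto simp: h_def m_def t_def)
    note c = gc[OF v(1)] gc[OF v(2)] Gc[OF v(2)] Gc[OF v(3)] Ra Rb
    have "?A \<alpha> * ?A \<beta> = (g h * R \<alpha> * G m) * (g m * R \<beta> * G t)"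
      using act[OF a] act[OF b] ab by (simp only: h_def m_def t_def)
    also have "\<dots> = g h * R \<alpha> * (G m * g m) * R \<beta> * G t"
      using c[THEN carrier_matD(1)] c[THEN carrier_matD(2)] by (simp add: mult_mat_assoc_dims)
    also have "\<dots> = g h * (R \<alpha> * R \<beta>) * G t"
      using c[THEN carrier_matD(1)] c[THEN carrier_matD(2)] Ra
      by (simp add: Gg[OF v(2)] mult_mat_assoc_dims)
    also have "\<dots> = 0\<^sub>m (?d h) (?d t)"
      unfolding z[folded h_def t_def] using c by (simp del: seesaw_simps)
    finally show ?thesis by (simp only: h_def t_def)
  qed
  have "R Gamma * R Gamma = 0\<^sub>m (2 * l) (2 * l)" "R (ArrS l) * R (Arr l) = 0\<^sub>m l l"
    using R l by (simp_all add: rep_variety_def)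
  then have "?A Gamma * ?A Gamma = 0\<^sub>m (2 * l) (2 * l)" "?A (ArrS l) * ?A (Arr l) = 0\<^sub>m l l"
    using comp[of Gamma Gamma] comp[of "ArrS l" "Arr l"] l by simp_all
  then show ?thesis
    using sp unfolding rep_variety_def by simp
qed

section \<open>The obstruction to a symmetric degeneration\<close>

text \<open>
  The columns of \<open>swapped_block\<close> are the upper halves of the columns of \<open>R\<^bsub>a\<^sub>l\<^esub> R\<^bsub>a\<^sub>l\<^sub>-\<^sub>1\<^esub>\<close>
  and, last, of the first column of \<open>R\<^sub>\<gamma> R\<^bsub>a\<^sub>l\<^esub> R\<^bsub>a\<^sub>l\<^sub>-\<^sub>1\<^esub>\<close>. The matrix products are written
  out because \<open>rep_polys\<close> are functions on all families of matrices, whatever their dimensions.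
\<close>

definition top_block :: "nat \<Rightarrow> (seesaw_arrow \<Rightarrow> complex mat) \<Rightarrow> nat \<times> nat \<Rightarrow> complex" where
  "top_block l R = (\<lambda>(r, c). R (Arr l) $$ (r, c))"

definition swapped_block :: "nat \<Rightarrow> (seesaw_arrow \<Rightarrow> complex mat) \<Rightarrow> nat \<times> nat \<Rightarrow> complex" where
  "swapped_block l R = (\<lambda>(r, c).
     if c < l - 1 then \<Sum>k<l. R (Arr l) $$ (r, k) * R (Arr (l - 1)) $$ (k, c)
     else \<Sum>j<2*l. R Gamma $$ (r, j) * (\<Sum>k<l. R (Arr l) $$ (j, k) * R (Arr (l - 1)) $$ (k, 0)))"

definition family_poly :: "nat \<Rightarrow> (seesaw_arrow \<Rightarrow> complex mat) \<Rightarrow> complex" where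
  "family_poly l R = det (mat l l (top_block l R)) * det (mat l l (swapped_block l R))"

lemma family_poly_in_rep_polys:
  assumes l: "l \<ge> 2"
  shows "family_poly l \<in> rep_polys (seesaw l) (seesaw_dim l)"
proof -
  let ?P = "rep_polys (seesaw l) (seesaw_dim l)"
  have Gamma: "(\<lambda>R. R Gamma $$ (i, j)) \<in> ?P" if "i < 2 * l" "j < 2 * l" for i j
    by (rule rep_polys.coord) (use that in auto)
  have Arr: "(\<lambda>R. R (Arr l) $$ (i, j)) \<in> ?P" if "i < 2 * l" "j < l" for i j
    by (rule rep_polys.coord) (use that l in auto)
  have Arr': "(\<lambda>R. R (Arr (l - 1)) $$ (i, j)) \<in> ?P" if "i < l" "j < l - 1" for i j
    by (rule rep_polys.coord) (use that l in auto)
  have "(\<lambda>R. top_block l R (i, j)) \<in> ?P" if "i < l" "j < l" for i j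
    using that Arr by (simp add: top_block_def)
  moreover have "(\<lambda>R. swapped_block l R (i, j)) \<in> ?P" if "i < l" "j < l" for i j
  proof (cases "j < l - 1")
    case True
    then show ?thesis
      unfolding swapped_block_def using that
      by (auto intro!: rep_polys_sum rep_polys.mult Arr Arr' simp del: One_nat_def)
  next
    case False
    then show ?thesis
      unfolding swapped_block_def using that l
      by (auto intro!: rep_polys_sum rep_polys.mult Gamma Arr Arr' simp del: One_nat_def)
  qed
  ultimately have "(\<lambda>R. det (mat l l (top_block l R)) * det (mat l l (swapped_block l R))) \<in> ?P"
    by (intro rep_polys.mult rep_polys_det)
  then show ?thesis
    unfolding family_poly_def .
qed

lemma isometry_graded_hyp_form:
  assumes g: "g \<in> isometry_graded (seesaw l) (seesaw_dim l) (seesaw_form l)"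
    and v: "v \<in> carrier_vec (2 * l)" and w: "w \<in> carrier_vec (2 * l)"
  shows "hyp_form l (g Omega *\<^sub>v v) (g Omega *\<^sub>v w) = hyp_form l v w"
proof -
  define e where "e u = (\<lambda>j\<in>verts (seesaw l). if j = Omega then u else 0\<^sub>v (seesaw_dim l j))" for u :: "complex vec"
  have e: "e u \<in> graded_space (seesaw l) (seesaw_dim l)" if "u \<in> carrier_vec (2 * l)" for u
    using that unfolding e_def graded_space_def by auto
  have gc: "g j \<in> carrier_mat (seesaw_dim l j) (seesaw_dim l j)" if "j \<in> verts (seesaw l)" for j
  proof -
    have "g \<in> GL_graded (seesaw l) (seesaw_dim l)"
      using g by (simp add: isometry_graded_def)
    then have "g j \<in> Units (ring_mat TYPE(complex) (seesaw_dim l j) ())"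
      using that unfolding GL_graded_def by (rule PiE_mem)
    then show ?thesis by (rule Units_ring_mat_inv(1))
  qed
  have "seesaw_form l (e v) (e w) = hyp_form l v w"
    unfolding seesaw_form_hyp_form by (simp add: e_def)
  moreover have "seesaw_form l (vec_act (seesaw l) g (e v)) (vec_act (seesaw l) g (e w)) =
      hyp_form l (g Omega *\<^sub>v v) (g Omega *\<^sub>v w)"
  proof -
    have z: "vec_act (seesaw l) g (e u) (Vtx i) $ k = 0" "vec_act (seesaw l) g (e u) (VtxS i) $ k = 0"
      if "i \<in> {1..l}" "k < i" for u i k
      using that gc[of "Vtx i"] gc[of "VtxS i"] by (auto simp: vec_act_def e_def)
    have "vec_act (seesaw l) g (e u) Omega = g Omega *\<^sub>v u" for u
      by (simp add: vec_act_def e_def)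
    then show ?thesis
      unfolding seesaw_form_hyp_form by (simp add: z)
  qed
  ultimately show ?thesis
    using g e[OF v] e[OF w] by (simp add: isometry_graded_def)
qed

lemma family_poly_orbit:
  assumes l: "l \<ge> 2" and g: "g \<in> isometry_graded (seesaw l) (seesaw_dim l) (seesaw_form l)"
  shows "family_poly l (rep_act (seesaw l) (seesaw_dim l) g (M_rep l)) = 0"
proof -
  let ?d = "seesaw_dim l" and ?R = "rep_act (seesaw l) (seesaw_dim l) g (M_rep l)"
  define G where "G j = m_inv (ring_mat TYPE(complex) (seesaw_dim l j) ()) (g j)" for j
  have u: "g j \<in> Units (ring_mat TYPE(complex) (?d j) ())" if "j \<in> verts (seesaw l)" for j
  proof -
    have "g \<in> GL_graded (seesaw l) (seesaw_dim l)"
      using g by (simp add: isometry_graded_def)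
    then show ?thesis
      using that unfolding GL_graded_def by (rule PiE_mem)
  qed
  note gc = Units_ring_mat_inv(1)[OF u] and Gc = Units_ring_mat_inv(2)[OF u, folded G_def]
    and Gg = Units_ring_mat_inv(3)[OF u, folded G_def]
  have v: "Omega \<in> verts (seesaw l)" "Vtx l \<in> verts (seesaw l)" "Vtx (l - 1) \<in> verts (seesaw l)"
    using l by auto
  define E where "E = seesaw_maps l (M_gamma l) (Arr l)"
  define D where "D = seesaw_maps l (M_gamma l) (Arr (l - 1))"
  define X where "X = M_gamma l"
  note [simp] = gc[OF v(1), simplified] gc[OF v(2), simplified] gc[OF v(3), simplified]
    Gc[OF v(1), simplified] Gc[OF v(2), simplified] Gc[OF v(3), simplified]
  have [simp]: "E \<in> carrier_mat (2 * l) l" "D \<in> carrier_mat l (l - 1)" "X \<in> carrier_mat (2 * l) (2 * l)"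
    using l by (auto simp: E_def D_def X_def M_gamma_def)
  note dims [simp] = \<open>E \<in> _\<close>[THEN carrier_matD(1)] \<open>E \<in> _\<close>[THEN carrier_matD(2)]
    \<open>D \<in> _\<close>[THEN carrier_matD(1)] \<open>D \<in> _\<close>[THEN carrier_matD(2)]
    \<open>X \<in> _\<close>[THEN carrier_matD(1)] \<open>X \<in> _\<close>[THEN carrier_matD(2)]
    gc[OF v(1), THEN carrier_matD(1), simplified] gc[OF v(1), THEN carrier_matD(2), simplified]
    gc[OF v(2), THEN carrier_matD(1), simplified] gc[OF v(2), THEN carrier_matD(2), simplified]
    Gc[OF v(1), THEN carrier_matD(1), simplified] Gc[OF v(1), THEN carrier_matD(2), simplified]
    Gc[OF v(2), THEN carrier_matD(1), simplified] Gc[OF v(2), THEN carrier_matD(2), simplified]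
    Gc[OF v(3), THEN carrier_matD(1), simplified] Gc[OF v(3), THEN carrier_matD(2), simplified]
  define A where "A = g Omega * E * G (Vtx l)"
  define C where "C = g (Vtx l) * D * G (Vtx (l - 1))"
  define Y where "Y = g Omega * X * G Omega"
  have Ac: "A \<in> carrier_mat (2 * l) l" and Cc: "C \<in> carrier_mat l (l - 1)"
    and Yc: "Y \<in> carrier_mat (2 * l) (2 * l)"
    by (auto simp: A_def C_def Y_def intro!: carrier_matI)
  have R: "?R (Arr l) = A" "?R (Arr (l - 1)) = C" "?R Gamma = Y"
    using l by (auto simp: rep_act_def M_rep_def A_def C_def Y_def E_def D_def X_def G_def)
  define q where "q = D *\<^sub>v (G (Vtx (l - 1)) *\<^sub>v unit_vec (l - 1) 0)"
  have qc: "q \<in> carrier_vec l"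
    by (auto simp: q_def intro: carrier_vecI)
  define x where "x = Y *\<^sub>v (A *\<^sub>v (C *\<^sub>v unit_vec (l - 1) 0))"
  have Gg_vec: "G j *\<^sub>v (g j *\<^sub>v y) = y" if "j \<in> verts (seesaw l)" "y \<in> carrier_vec (?d j)" for j y
    using assoc_mult_mat_vec[OF Gc[OF that(1)] gc[OF that(1)] that(2)] Gg[OF that(1)] that(2) by simp
  have Av: "A *\<^sub>v y = g Omega *\<^sub>v (E *\<^sub>v (G (Vtx l) *\<^sub>v y))" if "y \<in> carrier_vec l" for y
    using that unfolding A_def
    by (simp add: mult_mat_vec_assoc_dims)
  have ACv: "A *\<^sub>v (C *\<^sub>v y) = g Omega *\<^sub>v (E *\<^sub>v (D *\<^sub>v (G (Vtx (l - 1)) *\<^sub>v y)))"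
    if "y \<in> carrier_vec (l - 1)" for y
  proof -
    have "G (Vtx (l - 1)) *\<^sub>v y \<in> carrier_vec (l - 1)"
      by (auto intro: carrier_vecI)
    then have "C *\<^sub>v y = g (Vtx l) *\<^sub>v (D *\<^sub>v (G (Vtx (l - 1)) *\<^sub>v y))"
      using that unfolding C_def
      by (simp add: mult_mat_vec_assoc_dims)
    moreover have "D *\<^sub>v (G (Vtx (l - 1)) *\<^sub>v y) \<in> carrier_vec l" "C *\<^sub>v y \<in> carrier_vec l"
      using Cc that by (auto intro: carrier_vecI)
    ultimately show ?thesis
      using Av[of "C *\<^sub>v y"] Gg_vec[OF v(2)] by (simp del: One_nat_def)
  qed
  have x: "x = g Omega *\<^sub>v (X *\<^sub>v (E *\<^sub>v q))"
  proof -
    have "E *\<^sub>v q \<in> carrier_vec (2 * l)"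
      by (auto intro: carrier_vecI)
    then show ?thesis
      unfolding x_def ACv[OF unit_vec_carrier] q_def[symmetric] Y_def
      using Gg_vec[OF v(1)]
      by (simp add: mult_mat_vec_assoc_dims)
  qed
  have Ei: "(E *\<^sub>v y) $ r = (if r < l then y $ r else 0)" if "y \<in> carrier_vec l" "r < 2 * l" for y r
    using Arr_map_index[OF that(1), of l r] that(2) unfolding E_def by simp
  have Di: "(D *\<^sub>v y) $ r = (if r < l - 1 then y $ r else 0)" if "y \<in> carrier_vec (l - 1)" "r < l" for y r
    using Arr_map_index[OF that(1), of l r] that(2) l unfolding D_def by (simp del: seesaw_maps.simps)
  have q_last: "q $ (l - 1) = 0"
    using l unfolding q_def by (subst Di) (auto intro: carrier_vecI)
  have Eq: "E *\<^sub>v q \<in> carrier_vec (2 * l)"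
    by (auto intro: carrier_vecI)
  have Xi: "(X *\<^sub>v (E *\<^sub>v q)) $ r = (if r = 2 * l - 1 then q $ 0 else 0)" if "r < 2 * l" for r
    using M_gamma_index[OF l Eq that] Ei[OF qc] q_last l that unfolding X_def by auto
  have form_X: "hyp_form l (X *\<^sub>v (E *\<^sub>v q)) w = q $ 0 * w $ (l - 1)" for w
    using hyp_form_M_gamma[OF l Eq, of w] Ei[OF qc] q_last l unfolding X_def by simp
  have iso: "hyp_form l (g Omega *\<^sub>v y) (g Omega *\<^sub>v w) = hyp_form l y w"
    if "y \<in> carrier_vec (2 * l)" "w \<in> carrier_vec (2 * l)" for y w
    by (rule isometry_graded_hyp_form[OF g that])
  have XEq: "X *\<^sub>v (E *\<^sub>v q) \<in> carrier_vec (2 * l)"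
    by (auto intro: carrier_vecI)
  have Ec: "E *\<^sub>v y \<in> carrier_vec (2 * l)" for y
    by (auto intro: carrier_vecI)
  have "det (mat l l (\<lambda>(r, c). A $$ (r, c))) *
    det (mat l l (\<lambda>(r, c). if c < l - 1 then (A * C) $$ (r, c) else x $ r)) = 0"
  proof (rule isotropic_leading_minors[OF Ac Cc])
    show "x \<in> carrier_vec (2 * l)" "l > 0"
      using l by (auto simp: x intro: carrier_vecI)
    show "hyp_form l (A *\<^sub>v a) (A *\<^sub>v b) = 0" if "a \<in> carrier_vec l" "b \<in> carrier_vec l" for a b
    proof -
      have "G (Vtx l) *\<^sub>v a \<in> carrier_vec l" "G (Vtx l) *\<^sub>v b \<in> carrier_vec l"
        by (auto intro: carrier_vecI)
      then show ?thesis
        unfolding Av[OF that(1)] Av[OF that(2)] iso[OF Ec Ec] by (simp add: hyp_form_def Ei del: index_mult_mat_vec)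
    qed
    show "hyp_form l (A *\<^sub>v (C *\<^sub>v y)) x = 0" if "y \<in> carrier_vec (l - 1)" for y
    proof -
      have c: "G (Vtx (l - 1)) *\<^sub>v y \<in> carrier_vec (l - 1)"
        "D *\<^sub>v (G (Vtx (l - 1)) *\<^sub>v y) \<in> carrier_vec l"
        by (auto intro: carrier_vecI)
      show ?thesis
        unfolding ACv[OF that] x iso[OF Ec XEq] hyp_form_commute[of l "E *\<^sub>v _"] form_X
        using l by (simp add: Ei[OF c(2)] Di[OF c(1)] del: index_mult_mat_vec One_nat_def)
    qed
    show "hyp_form l x x = 0"
      unfolding x iso[OF XEq XEq] form_X using Xi[of "l - 1"] l by simp
    show "x = 0\<^sub>v (2 * l)" if a: "a \<in> carrier_vec l" and xa: "x = A *\<^sub>v a" for a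
    proof -
      have Ga: "G (Vtx l) *\<^sub>v a \<in> carrier_vec l"
        by (auto intro: carrier_vecI)
      have "X *\<^sub>v (E *\<^sub>v q) = G Omega *\<^sub>v x"
        unfolding x using Gg_vec[OF v(1)] XEq by simp
      also have "\<dots> = E *\<^sub>v (G (Vtx l) *\<^sub>v a)"
        unfolding xa Av[OF a] using Gg_vec[OF v(1)] Ec by simp
      finally have "q $ 0 = (E *\<^sub>v (G (Vtx l) *\<^sub>v a)) $ (2 * l - 1)"
        using Xi[of "2 * l - 1"] l by simp
      also have "\<dots> = 0"
        using Ei[OF Ga, of "2 * l - 1"] l by auto
      finally have "X *\<^sub>v (E *\<^sub>v q) = 0\<^sub>v (2 * l)"
        using Xi XEq by (intro eq_vecI) auto
      then show ?thesis
        unfolding x by (auto intro!: eq_vecI)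
    qed
  qed
  moreover have "mat l l (\<lambda>(r, c). A $$ (r, c)) = mat l l (top_block l ?R)"
    by (rule eq_matI) (auto simp: top_block_def R)
  moreover have "mat l l (\<lambda>(r, c). if c < l - 1 then (A * C) $$ (r, c) else x $ r) = mat l l (swapped_block l ?R)"
  proof (rule eq_matI)
    fix r c assume "r < dim_row (mat l l (swapped_block l ?R))" "c < dim_col (mat l l (swapped_block l ?R))"
    then have rc: "r < l" "c < l" by auto
    have AC: "(A * C) $$ (i, j) = (\<Sum>k<l. A $$ (i, k) * C $$ (k, j))" if "i < 2 * l" "j < l - 1" for i j
      by (rule index_mult_mat_sum[OF Ac Cc that])
    have colc: "col (A * C) 0 \<in> carrier_vec (2 * l)"
      using Ac by (intro carrier_vecI) simp
    have "A *\<^sub>v (C *\<^sub>v unit_vec (l - 1) 0) = (A * C) *\<^sub>v unit_vec (l - 1) 0"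
      by (rule assoc_mult_mat_vec[OF Ac Cc unit_vec_carrier, symmetric])
    also have "\<dots> = col (A * C) 0"
      using Ac Cc l by (intro mult_unit_vec_col mult_carrier_mat) auto
    finally have "x $ r = (\<Sum>j<2*l. Y $$ (r, j) * col (A * C) 0 $ j)"
      unfolding x_def using index_mult_mat_vec_sum[OF Yc colc, of r] rc by simp
    also have "\<dots> = (\<Sum>j<2*l. Y $$ (r, j) * (\<Sum>k<l. A $$ (j, k) * C $$ (k, 0)))"
      using Ac Cc l AC[of _ 0] by (intro sum.cong) auto
    finally show "mat l l (\<lambda>(r, c). if c < l - 1 then (A * C) $$ (r, c) else x $ r) $$ (r, c) =
        mat l l (swapped_block l ?R) $$ (r, c)"
      using rc AC[of r c] by (simp add: swapped_block_def R R(2)[simplified])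
  qed auto
  ultimately show ?thesis
    by (simp only: family_poly_def)
qed

lemma family_poly_N:
  assumes l: "l \<ge> 2"
  shows "family_poly l (N_rep l) = 1"
proof -
  have R: "N_rep l (Arr l) = mat (2 * l) l (\<lambda>(r, c). if r = c then 1 else 0)"
    "N_rep l (Arr (l - 1)) = mat l (l - 1) (\<lambda>(r, c). if r = c then 1 else 0)"
    "N_rep l Gamma = N_gamma l"
    using l by (auto simp: N_rep_def)
  have "mat l l (top_block l (N_rep l)) = 1\<^sub>m l"
    by (rule eq_matI) (auto simp: top_block_def R)
  moreover have "mat l l (swapped_block l (N_rep l)) = 1\<^sub>m l"
  proof (rule eq_matI)
    fix r c assume "r < dim_row (1\<^sub>m l :: complex mat)" "c < dim_col (1\<^sub>m l :: complex mat)"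
    then have rc: "r < l" "c < l" by auto
    have prod: "(\<Sum>k<l. N_rep l (Arr l) $$ (i, k) * N_rep l (Arr (l - 1)) $$ (k, j)) = (if i = j then 1 else 0)"
      if "i < 2 * l" "j < l - 1" for i j
    proof -
      have "(\<Sum>k<l. N_rep l (Arr l) $$ (i, k) * N_rep l (Arr (l - 1)) $$ (k, j)) =
          (\<Sum>k<l. if j = k then if i = j then 1 else 0 else 0)"
        using that unfolding R by (intro sum.cong) auto
      then show ?thesis using that by auto
    qed
    have "(\<Sum>j<2*l. N_rep l Gamma $$ (r, j) *
        (\<Sum>k<l. N_rep l (Arr l) $$ (j, k) * N_rep l (Arr (l - 1)) $$ (k, 0))) =
        (\<Sum>j<2*l. if 0 = j then N_rep l Gamma $$ (r, 0) else 0)"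
      using l prod by (intro sum.cong) auto
    also have "\<dots> = (if r = l - 1 then 1 else 0)"
      using l rc by (auto simp: R N_gamma_def)
    finally show "mat l l (swapped_block l (N_rep l)) $$ (r, c) = 1\<^sub>m l $$ (r, c)"
      using rc prod[of r c] by (auto simp: swapped_block_def)
  qed auto
  ultimately show ?thesis
    by (simp add: family_poly_def)
qed

lemma not_M_sym_deg_N:
  assumes l: "l \<ge> 2"
  shows "\<not> sym_deg_le (seesaw l) (seesaw_dim l) (seesaw_form l) (M_rep l) (N_rep l)"
proof
  let ?V = "rep_variety (seesaw l) (seesaw_dim l)"
  let ?O = "(\<lambda>g. rep_act (seesaw l) (seesaw_dim l) g (M_rep l)) `
    isometry_graded (seesaw l) (seesaw_dim l) (seesaw_form l)"
  let ?Z = "{R \<in> ?V. \<forall>p\<in>{family_poly l}. p R = 0}"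
  assume "sym_deg_le (seesaw l) (seesaw_dim l) (seesaw_form l) (M_rep l) (N_rep l)"
  moreover have "zariski_closed (seesaw l) (seesaw_dim l) ?Z"
    unfolding zariski_closed_def using family_poly_in_rep_polys[OF l] by blast
  moreover have "M_rep l \<in> ?V"
    using M_rep_sym[OF l] by (simp add: sym_rep_variety_def)
  then have "?O \<subseteq> ?Z"
    using seesaw_rep_act_variety family_poly_orbit[OF l] l by (auto simp: isometry_graded_def)
  ultimately have "N_rep l \<in> ?Z"
    unfolding sym_deg_le_def hull_def by blast
  then show False
    using family_poly_N[OF l] by simp
qed

theorem proposition4p2:
  fixes l :: nat
  assumes "l \<ge> 2"
  shows "eps_form (seesaw l) (seesaw_dim l) 1 (seesaw_form l) \<and>
    M_rep l \<in> sym_rep_variety (seesaw l) (seesaw_dim l) (seesaw_form l) \<and>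
    N_rep l \<in> sym_rep_variety (seesaw l) (seesaw_dim l) (seesaw_form l) \<and>
    deg_le (seesaw l) (seesaw_dim l) (M_rep l) (N_rep l) \<and>
    \<not> sym_deg_le (seesaw l) (seesaw_dim l) (seesaw_form l) (M_rep l) (N_rep l) \<and>
    \<not> (\<forall>A \<in> sym_rep_variety (seesaw l) (seesaw_dim l) (seesaw_form l).
         \<forall>B \<in> sym_rep_variety (seesaw l) (seesaw_dim l) (seesaw_form l).
           deg_le (seesaw l) (seesaw_dim l) A B \<longleftrightarrow>
           sym_deg_le (seesaw l) (seesaw_dim l) (seesaw_form l) A B)"
  using seesaw_eps_form M_rep_sym[OF assms] N_rep_sym[OF assms] M_deg_N[OF assms]
    not_M_sym_deg_N[OF assms]
  by blast

end
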